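(* Let $\mathcal H$ be a graded connected Hopf algebra over $\mathbb R$, and $\tau:\mathcal H\to\mathcal H$ a linear graded involution that is an algebra morphism and a coalgebra morphism or antimorphism. Fix $a$ odd, and let $\tau^+_a=m\circ(\mathrm{id}\otimes\tau\otimes\mathrm{id}\otimes\cdots\otimes\tau\otimes\mathrm{id})\circ\Delta^{[a]}$ and $\tau^-_a=m\circ(\tau\otimes\mathrm{id}\otimes\tau\otimes\cdots\otimes\mathrm{id}\otimes\tau)\circ\Delta^{[a]}$ (with $a$ alternating tensor factors). (i) For $p_1,\dots,p_k\in(\mathrm{Prim}\,\mathcal H)^{\tau}$ and $\bar p_1,\dots,\bar p_{\bar k}\in(\mathrm{Prim}\,\mathcal H)^{-\tau}$ ($k$ or $\bar k$ may be $0$), the element $$\sum_{B}\Big(\overleftarrow{\prod_{i\in B_1}}\bar p_i\Big)\Big(\sum_{\sigma\in\mathfrak S_k}p_{\sigma(1)}\cdots p_{\sigma(k)}\Big)\Big(\prod_{i\in B_2}\bar p_i\Big),$$ summing over all set-compositions $B=B_1|B_2$ of $\{1,\dots,\bar k\}$ into two (possibly empty) blocks, where $\prod_{i\in B_2}$ is taken in increasing order of $i$ and $\overleftarrow{\prod}_{i\in B_1}$ in decreasing order of $i$, is an eigenvector of $\tau^+_a$ with eigenvalue $a^k$ and an eigenvector of $\tau^-_a$ with eigenvalue $(-1)^{\bar k}a^k$. (ii) If $\mathcal P,\bar{\mathcal P}$ are bases of $(\mathrm{Prim}\,\mathcal H)^{\tau},(\mathrm{Prim}\,\mathcal H)^{-\tau}$,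 each totally ordered by $\preceq$, then the vectors in (i), over all $k,\bar k\ge0$ and all choices $p_1\preceq\cdots\preceq p_k$ in $\mathcal P$ and $\bar p_1\preceq\cdots\preceq\bar p_{\bar k}$ in $\bar{\mathcal P}$, are linearly independent. (iii) If moreover $\mathcal H$ is cocommutative, the set in (ii) is a basis of $\mathcal H$ consisting of eigenvectors of both $\tau^+_a$ and $\tau^-_a$.
   Context: Graded connected Hopf algebra over $\mathbb R$: $\mathcal H=\bigoplus_n\mathcal H_n$, $\mathcal H_0=\mathbb R\cdot1$, product $m$ (iterated products also denoted $m$), coproduct $\Delta$; $\Delta^{[2]}=\Delta$, $\Delta^{[l]}=(\Delta^{[l-1]}\otimes\mathrm{id})\circ\Delta$. $\mathrm{Prim}\,\mathcal H=\{x:\Delta(x)=1\otimes x+x\otimes1\}$. Algebra morphism: $f(wz)=f(w)f(z)$; coalgebra morphism: $\Delta\circ f=(f\otimes f)\circ\Delta$; coalgebra antimorphism: $\Delta\circ f=(f\otimes f)\circ\mathrm{swap}\circ\Delta$. $V^{\pm\tau}$ are the $\pm1$-eigenspaces of $\tau$. A set-composition of a set $S$ is a sequence of possibly empty disjoint subsets (blocks) with union $S$. $\mathcal H$ is cocommutative if $\Delta(x)$ is invariant under swapping tensor factors. *)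

theory Defs
  imports "HOL-Analysis.Finite_Function_Topology" "HOL-Combinatorics.Permutations"
begin

section \<open>Tensor powers of a real vector space\<close>

text \<open>
  All tensor powers of a real vector space \<open>V\<close> live in one type, the direct sum of
  \<open>V\<^sup>\<otimes>\<^sup>n\<close> over \<open>n \<ge> 0\<close>: the free real vector space on lists over \<open>V\<close>,
  modulo multilinearity. Working in this sum makes it possible to let the number of tensor
  factors be a variable.
\<close>

definition multilinear_relations :: "('a::real_vector list \<Rightarrow>\<^sub>0 real) set" where
  "multilinear_relations =
     {Poly_Mapping.single (xs @ (x + y) # ys) 1
        - Poly_Mapping.single (xs @ x # ys) 1
        - Poly_Mapping.single (xs @ y # ys) 1 | xs x y ys. True} \<union>
     {Poly_Mapping.single (xs @ (c *\<^sub>R x) # ys) 1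
        - c *\<^sub>R Poly_Mapping.single (xs @ x # ys) 1 | xs c x ys. True}"

definition tensor_equiv ::
    "('a::real_vector list \<Rightarrow>\<^sub>0 real) \<Rightarrow> ('a list \<Rightarrow>\<^sub>0 real) \<Rightarrow> bool" where
  "tensor_equiv s t \<longleftrightarrow> s - t \<in> span multilinear_relations"

lemma tensor_equiv_refl: "tensor_equiv s s"
  by (simp add: tensor_equiv_def span_zero)

quotient_type (overloaded) 'a tensors = "'a::real_vector list \<Rightarrow>\<^sub>0 real" / tensor_equiv
proof (rule equivpI)
  show "reflp tensor_equiv"
    by (rule reflpI) (rule tensor_equiv_refl)
  show "symp tensor_equiv"
  proof (rule sympI)
    fix s t
    assume "tensor_equiv s t"
    then show "tensor_equiv t s"
      using span_neg[of "s - t" multilinear_relations] by (simp add: tensor_equiv_def)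
  qed
  show "transp tensor_equiv"
  proof (rule transpI)
    fix s t u
    assume "tensor_equiv s t" "tensor_equiv t u"
    then show "tensor_equiv s u"
      using span_add[of "s - t" multilinear_relations "t - u"] by (simp add: tensor_equiv_def)
  qed
qed

instantiation tensors :: (real_vector) real_vector
begin

lift_definition zero_tensors :: "'a tensors" is 0 .

lift_definition plus_tensors :: "'a tensors \<Rightarrow> 'a tensors \<Rightarrow> 'a tensors" is "(+)"
proof -
  fix s t s' t' :: "'a list \<Rightarrow>\<^sub>0 real"
  assume "tensor_equiv s t" "tensor_equiv s' t'"
  then show "tensor_equiv (s + s') (t + t')"
    using span_add[of "s - t" multilinear_relations "s' - t'"]
    by (simp add: tensor_equiv_def add_diff_add)
qed

lift_definition uminus_tensors :: "'a tensors \<Rightarrow> 'a tensors" is uminus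
proof -
  fix s t :: "'a list \<Rightarrow>\<^sub>0 real"
  assume "tensor_equiv s t"
  then show "tensor_equiv (- s) (- t)"
    using span_neg[of "s - t" multilinear_relations] by (simp add: tensor_equiv_def)
qed

lift_definition minus_tensors :: "'a tensors \<Rightarrow> 'a tensors \<Rightarrow> 'a tensors" is "(-)"
proof -
  fix s t s' t' :: "'a list \<Rightarrow>\<^sub>0 real"
  assume "tensor_equiv s t" "tensor_equiv s' t'"
  moreover have "s - s' - (t - t') = (s - t) - (s' - t')"
    by simp
  ultimately show "tensor_equiv (s - s') (t - t')"
    using span_diff[of "s - t" multilinear_relations "s' - t'"]
    by (simp only: tensor_equiv_def)
qed

lift_definition scaleR_tensors :: "real \<Rightarrow> 'a tensors \<Rightarrow> 'a tensors" is "scaleR"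
proof -
  fix c :: real and s t :: "'a list \<Rightarrow>\<^sub>0 real"
  assume "tensor_equiv s t"
  then show "tensor_equiv (c *\<^sub>R s) (c *\<^sub>R t)"
    using span_scale[of "s - t" multilinear_relations c]
    by (simp add: tensor_equiv_def scaleR_diff_right)
qed

instance
proof
  fix x y z :: "'a tensors" and c d :: real
  show "x + y + z = x + (y + z)"
    by transfer (simp only: add.assoc tensor_equiv_refl)
  show "x + y = y + x"
    by transfer (metis add.commute tensor_equiv_refl)
  show "0 + x = x"
    by transfer (simp only: add_0_left tensor_equiv_refl)
  show "- x + x = 0"
    by transfer (simp only: left_minus tensor_equiv_refl)
  show "x - y = x + - y"
    by transfer (simp only: diff_conv_add_uminus tensor_equiv_refl)
  show "c *\<^sub>R (x + y) = c *\<^sub>R x + c *\<^sub>R y"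
    by transfer (simp only: scaleR_add_right tensor_equiv_refl)
  show "(c + d) *\<^sub>R x = c *\<^sub>R x + d *\<^sub>R x"
    by transfer (simp only: scaleR_add_left tensor_equiv_refl)
  show "c *\<^sub>R d *\<^sub>R x = (c * d) *\<^sub>R x"
    by transfer (simp only: scaleR_scaleR tensor_equiv_refl)
  show "1 *\<^sub>R x = x"
    by transfer (simp only: scaleR_one tensor_equiv_refl)
qed

end

lift_definition pure_tensor :: "'a::real_vector list \<Rightarrow> 'a tensors"
  is "\<lambda>xs. Poly_Mapping.single xs 1" .

definition tensor_power :: "nat \<Rightarrow> 'a::real_vector tensors set" where
  "tensor_power n = span (pure_tensor ` {xs. length xs = n})"

definition multilinear :: "('a::real_vector list \<Rightarrow> 'b::real_vector) \<Rightarrow> bool" where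
  "multilinear F \<longleftrightarrow> (\<forall>xs ys. linear (\<lambda>x. F (xs @ x # ys)))"

text \<open>The linear map out of the tensor powers induced by a map that is multilinear on
  lists of each length; only meaningful for such maps.\<close>

definition tensor_lift ::
    "('a::real_vector list \<Rightarrow> 'b::real_vector) \<Rightarrow> 'a tensors \<Rightarrow> 'b" where
  "tensor_lift F = (SOME g. linear g \<and> (\<forall>xs. g (pure_tensor xs) = F xs))"

definition tensor_lift2 ::
    "('a::real_vector \<Rightarrow> 'a \<Rightarrow> 'b::real_vector) \<Rightarrow> 'a tensors \<Rightarrow> 'b" where
  "tensor_lift2 f = tensor_lift (\<lambda>xs. case xs of [u, v] \<Rightarrow> f u v | _ \<Rightarrow> 0)"

lemma pure_tensor_multilinear: "multilinear (pure_tensor :: 'a::real_vector list \<Rightarrow> _)"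
  unfolding multilinear_def
proof (intro allI linearI)
  fix xs ys :: "'a list" and x y :: 'a and c :: real
  have *: "tensor_equiv s t" if "s - t \<in> multilinear_relations"
    for s t :: "'a list \<Rightarrow>\<^sub>0 real"
    using that by (simp add: tensor_equiv_def span_base)
  have "Poly_Mapping.single (xs @ (x + y) # ys) (1::real)
        - (Poly_Mapping.single (xs @ x # ys) 1 + Poly_Mapping.single (xs @ y # ys) 1)
      \<in> multilinear_relations"
    unfolding multilinear_relations_def diff_diff_eq[symmetric] by blast
  then show "pure_tensor (xs @ (x + y) # ys) = pure_tensor (xs @ x # ys) + pure_tensor (xs @ y # ys)"
    by (simp only: pure_tensor.abs_eq plus_tensors.abs_eq tensors.abs_eq_iff *)
  have "Poly_Mapping.single (xs @ (c *\<^sub>R x) # ys) (1::real)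
        - c *\<^sub>R Poly_Mapping.single (xs @ x # ys) 1 \<in> multilinear_relations"
    unfolding multilinear_relations_def by blast
  then show "pure_tensor (xs @ (c *\<^sub>R x) # ys) = c *\<^sub>R pure_tensor (xs @ x # ys)"
    by (simp only: pure_tensor.abs_eq scaleR_tensors.abs_eq tensors.abs_eq_iff *)
qed

lemma lookup_scaleR_poly_mapping:
  "Poly_Mapping.lookup (c *\<^sub>R f) x = c *\<^sub>R Poly_Mapping.lookup (f :: 'a \<Rightarrow>\<^sub>0 real) x"
proof -
  have "finite {i. c *\<^sub>R Poly_Mapping.lookup f i \<noteq> 0}"
    by (rule finite_subset[OF _ finite_lookup[of f]]) auto
  then show ?thesis
    by (simp add: scaleR_poly_mapping_def Abs_poly_mapping_inverse)
qed

lemma free_sum_expand: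
  fixes s :: "'b \<Rightarrow>\<^sub>0 real"
  shows "s = (\<Sum>x\<in>Poly_Mapping.keys s. Poly_Mapping.lookup s x *\<^sub>R Poly_Mapping.single x 1)"
proof (rule poly_mapping_eqI)
  fix k
  show "Poly_Mapping.lookup s k = Poly_Mapping.lookup
     (\<Sum>x\<in>Poly_Mapping.keys s. Poly_Mapping.lookup s x *\<^sub>R Poly_Mapping.single x 1) k"
    by (simp add: lookup_sum lookup_scaleR_poly_mapping lookup_single when_def
        in_keys_iff if_distrib sum.delta' cong: if_cong)
qed

lemma tensors_span_pure: "span (range pure_tensor) = (UNIV :: 'a::real_vector tensors set)"
proof -
  have lin: "linear (abs_tensors :: _ \<Rightarrow> 'a tensors)"
    by (rule linearI) (simp_all add: plus_tensors.abs_eq scaleR_tensors.abs_eq)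
  have "t \<in> span (range pure_tensor)" for t :: "'a tensors"
  proof -
    obtain s where s: "t = abs_tensors s"
      by (metis Quotient_tensors Quotient_abs_rep)
    have "t = (\<Sum>x\<in>Poly_Mapping.keys s. Poly_Mapping.lookup s x *\<^sub>R pure_tensor x)"
      unfolding s
      by (subst free_sum_expand[of s])
        (simp add: linear_sum[OF lin] linear_scale[OF lin] pure_tensor.abs_eq)
    then show ?thesis
      by (metis (no_types, lifting) rangeI span_base span_scale span_sum)
  qed
  then show ?thesis by auto
qed

lemma tensor_lift_exists:
  fixes F :: "'a::real_vector list \<Rightarrow> 'b::real_vector"
  assumes F: "multilinear F"
  shows "\<exists>g. linear g \<and> (\<forall>xs. g (pure_tensor xs) = F xs)"
proof -
  define G where "G s = (\<Sum>x\<in>Poly_Mapping.keys s. Poly_Mapping.lookup s x *\<^sub>R F x)"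
    for s :: "'a list \<Rightarrow>\<^sub>0 real"
  have G_sup: "G s = (\<Sum>x\<in>A. Poly_Mapping.lookup s x *\<^sub>R F x)"
    if "finite A" "Poly_Mapping.keys s \<subseteq> A" for s A
    unfolding G_def using that by (intro sum.mono_neutral_left) (auto simp: in_keys_iff)
  have G_lin: "linear G"
  proof (rule linearI)
    fix s t :: "'a list \<Rightarrow>\<^sub>0 real" and c :: real
    let ?A = "Poly_Mapping.keys s \<union> Poly_Mapping.keys t"
    have "G (s + t) = (\<Sum>x\<in>?A. Poly_Mapping.lookup (s + t) x *\<^sub>R F x)"
      by (rule G_sup) (auto simp: in_keys_iff lookup_add)
    then show "G (s + t) = G s + G t"
      by (simp add: G_sup[of ?A] lookup_add scaleR_add_left sum.distrib)
    have "G (c *\<^sub>R s) = (\<Sum>x\<in>Poly_Mapping.keys s. Poly_Mapping.lookup (c *\<^sub>R s) x *\<^sub>R F x)"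
      by (rule G_sup) (auto simp: in_keys_iff lookup_scaleR_poly_mapping)
    then show "G (c *\<^sub>R s) = c *\<^sub>R G s"
      by (simp add: G_def lookup_scaleR_poly_mapping scaleR_sum_right)
  qed
  have G_single: "G (Poly_Mapping.single xs 1) = F xs" for xs
    by (simp add: G_def)
  have F_lin: "linear (\<lambda>x. F (xs @ x # ys))" for xs ys
    using F by (simp add: multilinear_def)
  have "G r = 0" if "r \<in> multilinear_relations" for r
    using that linear_add[OF F_lin] linear_scale[OF F_lin]
    by (auto simp: multilinear_relations_def linear_diff[OF G_lin]
        linear_scale[OF G_lin] G_single)
  then have ker: "G r = 0" if "r \<in> span multilinear_relations" for r
    using that by (metis G_lin linear_eq_0_on_span)
  have resp: "G s = G t" if "tensor_equiv s t" for s t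
    using ker[of "s - t"] that by (simp add: tensor_equiv_def linear_diff[OF G_lin])
  define g where "g t = G (rep_tensors t)" for t
  have g_abs: "g (abs_tensors s) = G s" for s
    unfolding g_def
    by (rule resp) (simp add: tensors.abs_eq_iff[symmetric] Quotient3_abs_rep[OF Quotient3_tensors])
  have "linear g"
  proof (rule linearI)
    fix s t :: "'a tensors" and c :: real
    obtain s' t' where st: "s = abs_tensors s'" "t = abs_tensors t'"
      by (metis Quotient_tensors Quotient_abs_rep)
    show "g (s + t) = g s + g t"
      by (simp add: st plus_tensors.abs_eq g_abs linear_add[OF G_lin])
    show "g (c *\<^sub>R s) = c *\<^sub>R g s"
      by (simp add: st scaleR_tensors.abs_eq g_abs linear_scale[OF G_lin])
  qed
  moreover have "g (pure_tensor xs) = F xs" for xs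
    by (simp add: pure_tensor.abs_eq g_abs G_single)
  ultimately show ?thesis by blast
qed

lemma
  assumes "multilinear F"
  shows linear_tensor_lift: "linear (tensor_lift F)"
    and tensor_lift_pure: "tensor_lift F (pure_tensor xs) = F xs"
  using someI_ex[OF tensor_lift_exists[OF assms]] by (simp_all add: tensor_lift_def)

definition tensor_map :: "('a::real_vector \<Rightarrow> 'a) list \<Rightarrow> 'a tensors \<Rightarrow> 'a tensors" where
  "tensor_map fs = tensor_lift (\<lambda>xs. if length xs = length fs
      then pure_tensor (map2 (\<lambda>f x. f x) fs xs) else 0)"

definition tensor_append :: "'a::real_vector tensors \<Rightarrow> 'a tensors \<Rightarrow> 'a tensors" where
  "tensor_append s t =
     tensor_lift (\<lambda>xs. tensor_lift (\<lambda>ys. pure_tensor (xs @ ys)) t) s"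

definition tensor_swap :: "'a::real_vector tensors \<Rightarrow> 'a tensors" where
  "tensor_swap = tensor_lift2 (\<lambda>u v. pure_tensor [v, u])"

definition tensor_times :: "'a::real_algebra_1 tensors \<Rightarrow> 'a tensors \<Rightarrow> 'a tensors" where
  "tensor_times s t =
     tensor_lift2 (\<lambda>u v. tensor_lift2 (\<lambda>u' v'. pure_tensor [u * u', v * v']) t) s"

definition tensor_mult :: "'a::real_algebra_1 tensors \<Rightarrow> 'a" where
  "tensor_mult = tensor_lift prod_list"


section \<open>Graded connected Hopf algebras\<close>

text \<open>The underlying unital algebra is a type of class \<^class>\<open>real_algebra_1\<close>;
  \<open>gr n\<close> is the homogeneous component of degree \<open>n\<close>.\<close>

locale graded_connected_hopf_algebra =
  fixes gr :: "nat \<Rightarrow> 'a::real_algebra_1 set"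
    and \<Delta> :: "'a \<Rightarrow> 'a tensors"
    and \<epsilon> :: "'a \<Rightarrow> real"
    and S :: "'a \<Rightarrow> 'a"
  assumes linear_coproduct: "linear \<Delta>"
    and coproduct_tensor_power: "\<Delta> x \<in> tensor_power 2"
    and linear_counit: "linear \<epsilon>"
    and linear_antipode: "linear S"
    and coassociative:
      "tensor_lift2 (\<lambda>u v. tensor_append (\<Delta> u) (pure_tensor [v])) (\<Delta> x) =
       tensor_lift2 (\<lambda>u v. tensor_append (pure_tensor [u]) (\<Delta> v)) (\<Delta> x)"
    and counit_left: "tensor_lift2 (\<lambda>u v. \<epsilon> u *\<^sub>R v) (\<Delta> x) = x"
    and counit_right: "tensor_lift2 (\<lambda>u v. \<epsilon> v *\<^sub>R u) (\<Delta> x) = x"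
    and coproduct_one: "\<Delta> 1 = pure_tensor [1, 1]"
    and coproduct_mult: "\<Delta> (x * y) = tensor_times (\<Delta> x) (\<Delta> y)"
    and counit_one: "\<epsilon> 1 = 1"
    and counit_mult: "\<epsilon> (x * y) = \<epsilon> x * \<epsilon> y"
    and antipode_left: "tensor_mult (tensor_map [S, id] (\<Delta> x)) = \<epsilon> x *\<^sub>R 1"
    and antipode_right: "tensor_mult (tensor_map [id, S] (\<Delta> x)) = \<epsilon> x *\<^sub>R 1"
    and subspace_gr: "subspace (gr n)"
    and direct_sum: "\<exists>!f. (\<forall>n. f n \<in> gr n) \<and> finite {n. f n \<noteq> 0} \<and>
                         x = (\<Sum>n | f n \<noteq> 0. f n)"
    and connected: "gr 0 = span {1}"
    and gr_mult: "x \<in> gr i \<Longrightarrow> y \<in> gr j \<Longrightarrow> x * y \<in> gr (i + j)"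
    and gr_coproduct: "x \<in> gr n \<Longrightarrow>
      \<Delta> x \<in> span {pure_tensor [u, v] | u v i j. i + j = n \<and> u \<in> gr i \<and> v \<in> gr j}"
    and gr_counit: "x \<in> gr n \<Longrightarrow> n > 0 \<Longrightarrow> \<epsilon> x = 0"
    and gr_antipode: "x \<in> gr n \<Longrightarrow> S x \<in> gr n"

definition cocommutative :: "('a::real_algebra_1 \<Rightarrow> 'a tensors) \<Rightarrow> bool" where
  "cocommutative \<Delta> \<longleftrightarrow> (\<forall>x. tensor_swap (\<Delta> x) = \<Delta> x)"

definition primitives :: "('a::real_algebra_1 \<Rightarrow> 'a tensors) \<Rightarrow> 'a set" where
  "primitives \<Delta> = {x. \<Delta> x = pure_tensor [1, x] + pure_tensor [x, 1]}"

definition coalgebra_morphism :: "('a::real_algebra_1 \<Rightarrow> 'a tensors) \<Rightarrow> ('a \<Rightarrow> 'a) \<Rightarrow> bool" where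
  "coalgebra_morphism \<Delta> f \<longleftrightarrow> (\<forall>x. \<Delta> (f x) = tensor_map [f, f] (\<Delta> x))"

definition coalgebra_antimorphism :: "('a::real_algebra_1 \<Rightarrow> 'a tensors) \<Rightarrow> ('a \<Rightarrow> 'a) \<Rightarrow> bool" where
  "coalgebra_antimorphism \<Delta> f \<longleftrightarrow> (\<forall>x. \<Delta> (f x) = tensor_map [f, f] (tensor_swap (\<Delta> x)))"

text \<open>The value at \<open>0\<close> is a dummy. The value at \<open>1\<close> is the identity,
  so that the value at \<open>2\<close> is \<open>\<Delta>\<close>.\<close>

fun iterated_coproduct :: "('a::real_algebra_1 \<Rightarrow> 'a tensors) \<Rightarrow> nat \<Rightarrow> 'a \<Rightarrow> 'a tensors" where
  "iterated_coproduct \<Delta> 0 x = 0"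
| "iterated_coproduct \<Delta> (Suc 0) x = pure_tensor [x]"
| "iterated_coproduct \<Delta> (Suc (Suc l)) x =
     tensor_lift2 (\<lambda>u v. tensor_append (iterated_coproduct \<Delta> (Suc l) u) (pure_tensor [v])) (\<Delta> x)"

definition tau_plus :: "('a::real_algebra_1 \<Rightarrow> 'a tensors) \<Rightarrow> ('a \<Rightarrow> 'a) \<Rightarrow> nat \<Rightarrow> 'a \<Rightarrow> 'a" where
  "tau_plus \<Delta> \<tau> a x = tensor_mult
     (tensor_map (map (\<lambda>i. if even i then id else \<tau>) [0..<a]) (iterated_coproduct \<Delta> a x))"

definition tau_minus :: "('a::real_algebra_1 \<Rightarrow> 'a tensors) \<Rightarrow> ('a \<Rightarrow> 'a) \<Rightarrow> nat \<Rightarrow> 'a \<Rightarrow> 'a" where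
  "tau_minus \<Delta> \<tau> a x = tensor_mult
     (tensor_map (map (\<lambda>i. if even i then \<tau> else id) [0..<a]) (iterated_coproduct \<Delta> a x))"


section \<open>Eigenvectors\<close>

definition eigenspace_in :: "'a::real_vector set \<Rightarrow> ('a \<Rightarrow> 'a) \<Rightarrow> real \<Rightarrow> 'a set" where
  "eigenspace_in V f c = {v \<in> V. f v = c *\<^sub>R v}"

definition is_eigenvector :: "('a::real_vector \<Rightarrow> 'a) \<Rightarrow> real \<Rightarrow> 'a \<Rightarrow> bool" where
  "is_eigenvector f c v \<longleftrightarrow> v \<noteq> 0 \<and> f v = c *\<^sub>R v"

definition set_compositions2 :: "'i set \<Rightarrow> ('i set \<times> 'i set) set" where
  "set_compositions2 A = {(B1, B2). B1 \<union> B2 = A \<and> B1 \<inter> B2 = {}}"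

text \<open>The lists \<open>ps\<close> and \<open>qs\<close> hold \<open>p\<^sub>1, \<dots>, p\<^sub>k\<close> and the barred elements, indexed from \<open>0\<close>.\<close>

definition symmetrized_product :: "'a::real_algebra_1 list \<Rightarrow> 'a list \<Rightarrow> 'a" where
  "symmetrized_product ps qs =
     (\<Sum>(B1, B2) \<in> set_compositions2 {..<length qs}.
        prod_list (map ((!) qs) (rev (sorted_list_of_set B1)))
        * (\<Sum>\<sigma> | \<sigma> permutes {..<length ps}. prod_list (map (\<lambda>i. ps ! \<sigma> i) [0..<length ps]))
        * prod_list (map ((!) qs) (sorted_list_of_set B2)))"

definition sorted_lists_over :: "'a set \<Rightarrow> 'a rel \<Rightarrow> 'a list set" where
  "sorted_lists_over P r = {ps. set ps \<subseteq> P \<and> sorted_wrt (\<lambda>x y. (x, y) \<in> r) ps}"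

definition is_basis_of :: "'a::real_vector set \<Rightarrow> 'a set \<Rightarrow> bool" where
  "is_basis_of B V \<longleftrightarrow> independent B \<and> span B = V"


end

theory Submission
  imports Defs "HOL-Analysis.Linear_Algebra" "HOL-Computational_Algebra.Primes"
    "HOL-Computational_Algebra.Polynomial"
begin

text \<open>
  Adding a barred element \<open>q\<close> to the list replaces the vector \<open>x\<close> by the anticommutator
  \<open>q * x + x * q\<close>, and the alternating signs make \<open>\<tau>\<^sup>+\<^sub>a\<close> and \<open>\<tau>\<^sup>-\<^sub>a\<close> (anti)commute with
  this operation by telescoping. Without barred elements, the symmetrized product is by
  polarization a combination of powers \<open>p ^ k\<close> of \<open>\<tau>\<close>-invariant primitive elements, on which
  both maps act as \<open>a ^ k\<close>.

  Modulo products of fewer primitive elements, the vectors are nonzero multiples of ordered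
  products of primitive elements. A functional \<open>\<phi>\<close> with \<open>\<phi> 1 = 0\<close> has an \<open>n\<close>-th convolution
  power that kills products of fewer than \<open>n\<close> primitive elements and sends \<open>x\<^sub>1 \<cdots> x\<^sub>n\<close> to
  \<open>n! \<phi>(x\<^sub>1) \<cdots> \<phi>(x\<^sub>n)\<close>; varying \<open>\<phi>\<close> gives nonvanishing and linear independence.

  In the cocommutative case the convolution square of the identity is a coalgebra morphism.
  Comparing its eigenvalues on \<open>H\<close> and on \<open>H \<otimes> H\<close> shows, by induction on the degree, that \<open>H\<close>
  is spanned by powers of primitive elements, whence the vectors span.
\<close>

section \<open>Linear maps out of tensor powers\<close>

text \<open>The anticommutator is forced by the two ends of an alternating product. Distributing
  \<open>q * x + x * q\<close> over the slots puts \<open>q\<close> on either side of each factor;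
  at the border of two neighbouring slots the two contributions have opposite signs and cancel. For
  odd length both end slots carry the same map, so what survives is again an anticommutator. The
  factor \<open>n!\<close> counts the ways to hand \<open>n\<close> primitive factors to
  \<open>n\<close> slots: a slot left empty contributes \<open>\<phi> 1 = 0\<close>. Such
  \<open>\<phi>\<close> can be prescribed freely on a basis of primitive elements because the counit
  separates \<open>1\<close> from them. Passing to the reals in this way replaces a comparison with
  the enveloping algebra of the Lie algebra of primitive elements. In the cocommutative case the
  number 2 is decisive: the convolution square of the identity has eigenvalue \<open>2 ^ k\<close>
  on \<open>p ^ k\<close>, so the eigenvalue 2 means \<open>k = 1\<close>, while the reduced
  coproducts that occur involve only tensors of \<open>p ^ i\<close> and \<open>q ^ j\<close> with
  \<open>i + j \<noteq> 1\<close>.\<close>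

lemma linear_mult_left: "linear f \<Longrightarrow> linear (\<lambda>x. (c::'b::real_algebra) * f x)"
  by (auto simp: linear_iff algebra_simps)

lemma linear_mult_right: "linear f \<Longrightarrow> linear (\<lambda>x. f x * (c::'b::real_algebra))"
  by (auto simp: linear_iff algebra_simps)

lemma linear_scaleR_left: "linear f \<Longrightarrow> linear (\<lambda>x. f x *\<^sub>R c)"
  by (auto simp: linear_iff algebra_simps)

lemma linear_comp: "linear g \<Longrightarrow> linear f \<Longrightarrow> linear (\<lambda>x. g (f x))"
  by (auto simp: linear_iff)

lemma bilinear_left: "bilinear B \<Longrightarrow> linear f \<Longrightarrow> linear (\<lambda>x. B (f x) c)"
  by (auto simp: linear_iff bilinear_def)

lemma bilinear_right: "bilinear B \<Longrightarrow> linear f \<Longrightarrow> linear (\<lambda>x. B c (f x))"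
  by (auto simp: linear_iff bilinear_def)

lemma bilinearI:
  "(\<And>x. linear (B x)) \<Longrightarrow> (\<And>y. linear (\<lambda>x. B x y)) \<Longrightarrow> bilinear B"
  by (simp add: bilinear_def)

lemma bilinear_comp: "bilinear B \<Longrightarrow> linear f \<Longrightarrow> linear g \<Longrightarrow> bilinear (\<lambda>u v. B (f u) (g v))"
  by (auto simp: linear_iff bilinear_def)

lemma bilinear_add: "bilinear B \<Longrightarrow> bilinear C \<Longrightarrow> bilinear (\<lambda>u v. B u v + C u v)"
  by (auto simp: bilinear_def intro: linear_compose_add)

lemma bilinear_post: "linear L \<Longrightarrow> bilinear B \<Longrightarrow> bilinear (\<lambda>u v. L (B u v))"
  by (auto simp: linear_iff bilinear_def)

lemma bilinear_conv:
  "linear f \<Longrightarrow> linear g \<Longrightarrow> bilinear (\<lambda>u v. f u * (g v :: 'b::real_algebra))"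
  by (intro bilinearI linear_mult_left linear_mult_right)

lemma linear_pure_tensor: "linear (\<lambda>x. pure_tensor (xs @ x # ys))"
  using pure_tensor_multilinear unfolding multilinear_def by blast

lemma linear_pure_tensor1: "linear (\<lambda>x. pure_tensor [x])"
  using linear_pure_tensor[of "[]" "[]"] by simp

lemma bilinear_pure_tensor: "bilinear (\<lambda>u v. pure_tensor [u, v])"
proof (rule bilinearI)
  show "linear (\<lambda>v. pure_tensor [x, v])" for x :: 'a
    using linear_pure_tensor[of "[x]" "[]"] by simp
  show "linear (\<lambda>u. pure_tensor [u, x])" for x :: 'a
    using linear_pure_tensor[of "[]" "[x]"] by simp
qed

lemma linear_pure_tensor_2:
  "linear (\<lambda>x. pure_tensor [x, y :: 'b::real_vector])" "linear (\<lambda>x. pure_tensor [y :: 'b::real_vector, x])"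
  using bilinear_pure_tensor unfolding bilinear_def by auto

section \<open>Maps out of the tensor square\<close>

lemma multilinear_lift2:
  assumes "bilinear f"
  shows "multilinear (\<lambda>xs. case xs of [u, v] \<Rightarrow> f u v | _ \<Rightarrow> 0)"
  unfolding multilinear_def
proof (intro allI)
  fix xs ys
  show "linear (\<lambda>x. case xs @ x # ys of [u, v] \<Rightarrow> f u v | _ \<Rightarrow> 0)"
  proof (cases "length (xs @ undefined # ys) = 2")
    case True
    then consider a where "xs = [a]" "ys = []" | b where "xs = []" "ys = [b]"
      by (cases xs; cases ys) auto
    then show ?thesis
      using assms by cases (auto simp: bilinear_def)
  next
    case False
    then have "(case xs @ x # ys of [u, v] \<Rightarrow> f u v | _ \<Rightarrow> 0) = 0" for x
      by (auto split: list.splits dest: arg_cong[where f = length])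
    then show ?thesis by (simp add: linear_zero)
  qed
qed

lemma linear_tensor_lift2: "bilinear f \<Longrightarrow> linear (tensor_lift2 f)"
  unfolding tensor_lift2_def by (intro linear_tensor_lift multilinear_lift2)

lemma tensor_lift2_pure: "bilinear f \<Longrightarrow> tensor_lift2 f (pure_tensor [u, v]) = f u v"
  unfolding tensor_lift2_def by (simp add: tensor_lift_pure multilinear_lift2)

lemma linear_eq_tensors:
  assumes "linear f" "linear g" "\<And>xs. f (pure_tensor xs) = g (pure_tensor xs)"
  shows "f t = g t"
  using linear_eq_on_span[OF assms(1,2), of "range pure_tensor" t] assms(3) tensors_span_pure by auto

lemma linear_eq_tensor_power2:
  assumes "linear f" "linear g" "\<And>u v. f (pure_tensor [u, v]) = g (pure_tensor [u, v])"
    and "t \<in> tensor_power 2"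
  shows "f t = g t"
proof (rule linear_eq_on_span[OF assms(1,2)])
  show "t \<in> span (pure_tensor ` {xs. length xs = 2})"
    using assms(4) by (simp add: tensor_power_def)
qed (use assms(3) in \<open>auto simp: length_Suc_conv numeral_2_eq_2\<close>)

text \<open>\<open>tensor_lift\<close> is chosen by \<open>SOME\<close>, so linearity in the
  integrand is not built in. It is checked on the pure tensors of length two, which span
  \<open>tensor_power 2\<close>.\<close>

lemma linear_tensor_lift2_param:
  assumes B: "\<And>x. bilinear (B x)" and lin: "\<And>u v. linear (\<lambda>x. B x u v)" and t: "t \<in> tensor_power 2"
  shows "linear (\<lambda>x. tensor_lift2 (B x) t)"
proof (rule linearI)
  fix x y c
  show "tensor_lift2 (B (x + y)) t = tensor_lift2 (B x) t + tensor_lift2 (B y) t"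
  proof (rule linear_eq_tensor_power2[OF _ _ _ t])
    show "linear (\<lambda>t. tensor_lift2 (B x) t + tensor_lift2 (B y) t)"
      by (intro linear_compose_add linear_tensor_lift2 B)
  qed (simp_all only: linear_tensor_lift2 tensor_lift2_pure B, simp only: linear_add[OF lin])
  show "tensor_lift2 (B (c *\<^sub>R x)) t = c *\<^sub>R tensor_lift2 (B x) t"
  proof (rule linear_eq_tensor_power2[OF _ _ _ t])
    show "linear (\<lambda>t. c *\<^sub>R tensor_lift2 (B x) t)"
      by (intro linear_compose_scale_right linear_tensor_lift2 B)
  qed (simp_all only: linear_tensor_lift2 tensor_lift2_pure B, simp only: linear_scale[OF lin])
qed

lemma linear_tensor_lift2_comp:
  assumes "linear L" "bilinear B" "t \<in> tensor_power 2"
  shows "L (tensor_lift2 B t) = tensor_lift2 (\<lambda>u v. L (B u v)) t"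
proof (rule linear_eq_tensor_power2[OF _ _ _ assms(3)])
  show "linear (\<lambda>t. L (tensor_lift2 B t))"
    by (intro linear_comp[OF assms(1)] linear_tensor_lift2 assms)
  show "linear (tensor_lift2 (\<lambda>u v. L (B u v)))"
    by (rule linear_tensor_lift2[OF bilinear_post[OF assms(1,2)]])
qed (simp add: tensor_lift2_pure bilinear_post[OF assms(1,2)] assms(2))

lemma tensor_lift2_id: "t \<in> tensor_power 2 \<Longrightarrow> tensor_lift2 (\<lambda>u v. pure_tensor [u, v]) t = t"
  by (rule linear_eq_tensor_power2)
    (auto intro!: linear_tensor_lift2 linear_ident bilinear_pure_tensor
      simp: tensor_lift2_pure bilinear_pure_tensor)

section \<open>Maps between tensor powers, multiplication and concatenation\<close>

lemma multilinear_map2: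
  assumes "multilinear F" "\<forall>f \<in> set fs. linear f"
  shows "multilinear (\<lambda>xs. if length xs = length fs then F (map2 (\<lambda>f x. f x) fs xs) else 0)"
  unfolding multilinear_def
proof (intro allI)
  fix xs ys
  show "linear (\<lambda>x. if length (xs @ x # ys) = length fs
      then F (map2 (\<lambda>f x. f x) fs (xs @ x # ys)) else 0)"
  proof (cases "length (xs @ undefined # ys) = length fs")
    case True
    define gs where "gs = take (length xs) fs"
    define h where "h = fs ! length xs"
    define hs where "hs = drop (Suc (length xs)) fs"
    have fs: "fs = gs @ h # hs" and len: "length gs = length xs"
      using True by (simp_all add: gs_def h_def hs_def id_take_nth_drop)
    have "linear h" using assms(2) fs by auto
    then have "linear (\<lambda>x. F (map2 (\<lambda>f x. f x) gs xs @ h x # map2 (\<lambda>f x. f x) hs ys))"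
      using assms(1) linear_comp[of "\<lambda>y. F (map2 (\<lambda>f x. f x) gs xs @ y # map2 (\<lambda>f x. f x) hs ys)" h]
      unfolding multilinear_def by simp
    then show ?thesis using True len by (simp add: fs)
  qed (simp add: linear_zero)
qed

lemma
  assumes "\<forall>f \<in> set fs. linear f"
  shows linear_tensor_map: "linear (tensor_map fs)"
    and tensor_map_pure: "tensor_map fs (pure_tensor xs) =
      (if length xs = length fs then pure_tensor (map2 (\<lambda>f x. f x) fs xs) else 0)"
  unfolding tensor_map_def
  by (simp_all add: linear_tensor_lift tensor_lift_pure multilinear_map2[OF pure_tensor_multilinear assms])

lemma multilinear_prod_list: "multilinear (prod_list :: 'a::real_algebra_1 list \<Rightarrow> 'a)"
  by (auto simp: multilinear_def intro!: linear_mult_left linear_mult_right linear_ident)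

lemma linear_tensor_mult: "linear tensor_mult"
  and tensor_mult_pure: "tensor_mult (pure_tensor xs) = prod_list xs"
  unfolding tensor_mult_def by (simp_all add: linear_tensor_lift tensor_lift_pure multilinear_prod_list)

lemma multilinear_pure_append: "multilinear (\<lambda>ys. pure_tensor (xs @ ys))"
  unfolding multilinear_def
proof (intro allI)
  fix ys zs
  show "linear (\<lambda>x. pure_tensor (xs @ ys @ x # zs))"
    using linear_pure_tensor[of "xs @ ys" zs] by simp
qed

lemma linear_tensor_lift_append: "linear (\<lambda>t. tensor_lift (\<lambda>ys. pure_tensor (xs @ ys)) t)"
  by (intro linear_tensor_lift multilinear_pure_append)

text \<open>Needed for the outer of the two nested lifts in \<open>tensor_append\<close>. The inner
  lift sees \<open>xs\<close> only through its integrand, so linearity in one entry is tested on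
  pure \<open>t\<close>.\<close>

lemma multilinear_append_lift: "multilinear (\<lambda>xs. tensor_lift (\<lambda>ys. pure_tensor (xs @ ys)) (t :: 'a::real_vector tensors))"
  unfolding multilinear_def
proof (intro allI linearI)
  fix xs ys :: "'a list" and x y :: 'a and c
  have lin: "linear (\<lambda>x. pure_tensor ((xs @ x # ys) @ zs))" for zs
    using linear_pure_tensor[of xs "ys @ zs"] by simp
  let ?L = "\<lambda>x. tensor_lift (\<lambda>zs. pure_tensor ((xs @ x # ys) @ zs))"
  show "?L (x + y) t = ?L x t + ?L y t"
  proof (rule linear_eq_tensors[where t = t])
    show "linear (\<lambda>t. ?L x t + ?L y t)"
      by (intro linear_compose_add linear_tensor_lift multilinear_pure_append)
  qed (simp_all only: linear_tensor_lift tensor_lift_pure multilinear_pure_append, simp only: linear_add[OF lin])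
  show "?L (c *\<^sub>R x) t = c *\<^sub>R ?L x t"
  proof (rule linear_eq_tensors[where t = t])
    show "linear (\<lambda>t. c *\<^sub>R ?L x t)"
      by (intro linear_compose_scale_right linear_tensor_lift multilinear_pure_append)
  qed (simp_all only: linear_tensor_lift tensor_lift_pure multilinear_pure_append, simp only: linear_scale[OF lin])
qed

lemma bilinear_tensor_append: "bilinear tensor_append"
proof (rule bilinearI)
  have lin: "linear (\<lambda>s. tensor_append s t)" for t :: "'a tensors"
    unfolding tensor_append_def by (intro linear_tensor_lift multilinear_append_lift)
  then show "linear (\<lambda>s. tensor_append s t)" for t :: "'a tensors" .
  have pure: "tensor_append (pure_tensor xs) t = tensor_lift (\<lambda>ys. pure_tensor (xs @ ys)) t"
    for xs and t :: "'a tensors"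
    unfolding tensor_append_def by (simp only: tensor_lift_pure multilinear_append_lift)
  fix s :: "'a tensors"
  show "linear (tensor_append s)"
  proof (rule linearI)
    fix x y :: "'a tensors" and c
    show "tensor_append s (x + y) = tensor_append s x + tensor_append s y"
    proof (rule linear_eq_tensors[where t = s])
      show "linear (\<lambda>s. tensor_append s x + tensor_append s y)"
        by (intro linear_compose_add lin)
    qed (simp_all only: lin pure linear_add[OF linear_tensor_lift_append])
    show "tensor_append s (c *\<^sub>R x) = c *\<^sub>R tensor_append s x"
    proof (rule linear_eq_tensors[where t = s])
      show "linear (\<lambda>s. c *\<^sub>R tensor_append s x)"
        by (intro linear_compose_scale_right lin)
    qed (simp_all only: lin pure linear_scale[OF linear_tensor_lift_append])
  qed
qed

lemma tensor_append_pure: "tensor_append (pure_tensor xs) (pure_tensor ys) = pure_tensor (xs @ ys)"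
  unfolding tensor_append_def
  by (subst tensor_lift_pure[OF multilinear_append_lift])
    (rule tensor_lift_pure[OF multilinear_pure_append])

text \<open>The step that turns an iterated coproduct into an iterated convolution. On pure tensors
  of a length other than \<open>length fs\<close> both sides are 0.\<close>

lemma tensor_mult_map_append:
  assumes "\<forall>f \<in> set fs. linear f" "linear g"
  shows "tensor_mult (tensor_map (fs @ [g]) (tensor_append t (pure_tensor [v]))) =
    tensor_mult (tensor_map fs t) * g v"
proof (rule linear_eq_tensors[where t = t])
  have lin: "\<forall>f \<in> set (fs @ [g]). linear f" using assms by auto
  show "linear (\<lambda>t. tensor_mult (tensor_map (fs @ [g]) (tensor_append t (pure_tensor [v]))))"
    by (intro linear_comp[OF linear_tensor_mult] linear_comp[OF linear_tensor_map[OF lin]]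
        bilinear_left[OF bilinear_tensor_append] linear_ident)
  show "linear (\<lambda>t. tensor_mult (tensor_map fs t) * g v)"
    by (intro linear_mult_right linear_comp[OF linear_tensor_mult] linear_tensor_map assms)
  show "tensor_mult (tensor_map (fs @ [g]) (tensor_append (pure_tensor xs) (pure_tensor [v]))) =
    tensor_mult (tensor_map fs (pure_tensor xs)) * g v" for xs
  proof -
    have "length xs = length fs \<Longrightarrow> prod_list (map2 (\<lambda>f x. f x) (fs @ [g]) (xs @ [v])) =
        prod_list (map2 (\<lambda>f x. f x) fs xs) * g v"
      by simp
    then show ?thesis
      by (simp only: tensor_append_pure tensor_map_pure[OF lin] tensor_map_pure[OF assms(1)]
          tensor_mult_pure linear_0[OF linear_tensor_mult] length_append list.size if_distrib[of tensor_mult])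
        simp
  qed
qed

section \<open>Sweedler calculus and convolution\<close>

context graded_connected_hopf_algebra
begin

text \<open>Sweedler notation: the sum of \<open>B\<close> over the tensor terms of
  \<open>\<Delta> x\<close>. Nested uses stand for coproducts with more factors.\<close>

definition sweedler :: "('a \<Rightarrow> 'a \<Rightarrow> 'b::real_vector) \<Rightarrow> 'a \<Rightarrow> 'b" where
  "sweedler B x = tensor_lift2 B (\<Delta> x)"

lemma linear_sweedler: "bilinear B \<Longrightarrow> linear (sweedler B)"
  unfolding sweedler_def by (rule linear_comp[OF linear_tensor_lift2 linear_coproduct])

lemma sweedler_comp:
  "linear L \<Longrightarrow> bilinear B \<Longrightarrow> L (sweedler B x) = sweedler (\<lambda>u v. L (B u v)) x"
  unfolding sweedler_def by (rule linear_tensor_lift2_comp[OF _ _ coproduct_tensor_power])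

lemma linear_sweedler_param:
  assumes "\<And>y. bilinear (B y)" "\<And>u v. linear (\<lambda>y. B y u v)"
  shows "linear (\<lambda>y. sweedler (B y) x)"
  unfolding sweedler_def by (rule linear_tensor_lift2_param[OF assms coproduct_tensor_power])

lemma sweedler_add:
  assumes "bilinear B" "bilinear C"
  shows "sweedler (\<lambda>u v. B u v + C u v) x = sweedler B x + sweedler C x"
  unfolding sweedler_def
proof (rule linear_eq_tensor_power2[OF _ _ _ coproduct_tensor_power])
  show "linear (tensor_lift2 (\<lambda>u v. B u v + C u v))"
    by (rule linear_tensor_lift2[OF bilinear_add[OF assms]])
  show "linear (\<lambda>t. tensor_lift2 B t + tensor_lift2 C t)"
    by (intro linear_compose_add linear_tensor_lift2 assms)
qed (simp add: tensor_lift2_pure bilinear_add[OF assms] assms)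

lemma sweedler_one: "bilinear B \<Longrightarrow> sweedler B 1 = B 1 1"
  by (simp add: sweedler_def coproduct_one tensor_lift2_pure)

lemma sweedler_primitive: "bilinear B \<Longrightarrow> p \<in> primitives \<Delta> \<Longrightarrow> sweedler B p = B 1 p + B p 1"
  by (simp add: sweedler_def primitives_def linear_add[OF linear_tensor_lift2] tensor_lift2_pure)

lemma coproduct_eq_sweedler: "\<Delta> x = sweedler (\<lambda>u v. pure_tensor [u, v]) x"
  by (simp add: sweedler_def tensor_lift2_id coproduct_tensor_power)

lemma tensor_times_eq:
  "tensor_times (\<Delta> x) (\<Delta> y) =
     sweedler (\<lambda>u v. sweedler (\<lambda>u' v'. pure_tensor [u * u', v * v']) y) x"
  by (simp add: sweedler_def tensor_times_def)

lemma bilinear_mult_args: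
  fixes B :: "'a \<Rightarrow> 'a \<Rightarrow> 'b::real_vector"
  assumes "bilinear B"
  shows "bilinear (\<lambda>u' v'. B (u * u') (v * v'))"
  by (rule bilinear_comp[OF assms linear_mult_left[OF linear_ident] linear_mult_left[OF linear_ident]])

lemma bilinear_sweedler_mult_args:
  assumes "bilinear B"
  shows "bilinear (\<lambda>u v. sweedler (\<lambda>u' v'. B (u * u') (v * v')) y)"
  by (intro bilinearI linear_sweedler_param bilinear_mult_args assms
      bilinear_left[OF assms] bilinear_right[OF assms] linear_mult_right linear_ident)

lemma sweedler_mult:
  assumes "bilinear B"
  shows "sweedler B (x * y) = sweedler (\<lambda>u v. sweedler (\<lambda>u' v'. B (u * u') (v * v')) y) x"
proof -
  have "sweedler B (x * y) = tensor_lift2 B (sweedler (\<lambda>u v. sweedler (\<lambda>u' v'. pure_tensor [u * u', v * v']) y) x)"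
    by (simp add: sweedler_def[of B] coproduct_mult tensor_times_eq)
  also have "\<dots> = sweedler (\<lambda>u v. sweedler (\<lambda>u' v'. tensor_lift2 B (pure_tensor [u * u', v * v'])) y) x"
    by (simp only: sweedler_comp[OF linear_tensor_lift2[OF assms]]
        bilinear_sweedler_mult_args[OF bilinear_pure_tensor] bilinear_mult_args[OF bilinear_pure_tensor])
  finally show ?thesis by (simp add: tensor_lift2_pure assms)
qed

text \<open>\<open>\<Delta> p\<close> has two terms, so a primitive factor is absorbed by one of the
  two slots. The inductions on convolutions of products of primitive elements use this
  splitting.\<close>

lemma sweedler_mult_primitive:
  assumes "bilinear B" "p \<in> primitives \<Delta>"
  shows "sweedler B (x * p) = sweedler (\<lambda>u v. B u (v * p)) x + sweedler (\<lambda>u v. B (u * p) v) x"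
proof -
  have "bilinear (\<lambda>u v. B u (v * p))" "bilinear (\<lambda>u v. B (u * p) v)"
    by (auto intro!: bilinear_comp[OF assms(1)] linear_ident linear_mult_right)
  then show ?thesis
    by (simp add: sweedler_mult assms sweedler_primitive bilinear_mult_args sweedler_add)
qed

lemma sweedler_primitive_mult:
  assumes "bilinear B" "p \<in> primitives \<Delta>"
  shows "sweedler B (p * x) = sweedler (\<lambda>u v. B u (p * v)) x + sweedler (\<lambda>u v. B (p * u) v) x"
  by (simp add: sweedler_mult assms sweedler_primitive bilinear_sweedler_mult_args)

text \<open>The axiom \<open>coassociative\<close> is an equation between tensors of length three.
  Applying the lift of \<open>T\<close>, extended by 0 to lists of other lengths, turns it into an
  equation between nested sums.\<close>

lemma sweedler_coassoc:
  fixes T :: "'a \<Rightarrow> 'a \<Rightarrow> 'a \<Rightarrow> 'b::real_vector"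
  assumes T12: "\<And>c. bilinear (\<lambda>a b. T a b c)" and T23: "\<And>a. bilinear (T a)"
  shows "sweedler (\<lambda>u v. sweedler (\<lambda>a b. T a b v) u) x = sweedler (\<lambda>u v. sweedler (T u) v) x"
proof -
  define F where "F xs = (case xs of [a, b, c] \<Rightarrow> T a b c | _ \<Rightarrow> 0)" for xs
  have F: "multilinear F"
    unfolding multilinear_def
  proof (intro allI)
    fix xs ys
    show "linear (\<lambda>x. F (xs @ x # ys))"
    proof (cases "length (xs @ undefined # ys) = 3")
      case True
      then consider a b where "xs = [a, b]" "ys = []" | a b where "xs = [a]" "ys = [b]" | a b where "xs = []" "ys = [a, b]"
        by (cases xs; cases "tl xs"; cases ys; cases "tl ys") auto
      then show ?thesis
        using T12 T23 by cases (auto simp: bilinear_def F_def)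
    next
      case False
      then have "F (xs @ x # ys) = 0" for x
        unfolding F_def by (auto split: list.splits dest: arg_cong[where f = length])
      then show ?thesis by (simp add: linear_zero)
    qed
  qed
  have F3: "F [a, b, c] = T a b c" for a b c
    by (simp add: F_def)
  let ?G = "tensor_lift F"
  have G: "linear ?G" by (rule linear_tensor_lift[OF F])
  have left: "?G (tensor_append t (pure_tensor [v])) = tensor_lift2 (\<lambda>a b. T a b v) t"
    if "t \<in> tensor_power 2" for t v
  proof (rule linear_eq_tensor_power2[OF _ _ _ that])
    show "linear (\<lambda>t. ?G (tensor_append t (pure_tensor [v])))"
      by (intro linear_comp[OF G] bilinear_left[OF bilinear_tensor_append] linear_ident)
  qed (simp_all add: linear_tensor_lift2 T12 tensor_append_pure tensor_lift_pure F tensor_lift2_pure F3)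
  have right: "?G (tensor_append (pure_tensor [u]) t) = tensor_lift2 (T u) t"
    if "t \<in> tensor_power 2" for t u
  proof (rule linear_eq_tensor_power2[OF _ _ _ that])
    show "linear (\<lambda>t. ?G (tensor_append (pure_tensor [u]) t))"
      by (intro linear_comp[OF G] bilinear_right[OF bilinear_tensor_append] linear_ident)
  qed (simp_all add: linear_tensor_lift2 T23 tensor_append_pure tensor_lift_pure F tensor_lift2_pure F3)
  have "?G (sweedler (\<lambda>u v. tensor_append (\<Delta> u) (pure_tensor [v])) x) =
        ?G (sweedler (\<lambda>u v. tensor_append (pure_tensor [u]) (\<Delta> v)) x)"
    by (simp add: sweedler_def coassociative)
  moreover have "bilinear (\<lambda>u v. tensor_append (\<Delta> u) (pure_tensor [v]))"
    "bilinear (\<lambda>u v. tensor_append (pure_tensor [u]) (\<Delta> v))"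
    by (rule bilinear_comp[OF bilinear_tensor_append linear_coproduct linear_pure_tensor1],
        rule bilinear_comp[OF bilinear_tensor_append linear_pure_tensor1 linear_coproduct])
  ultimately show ?thesis
    by (simp add: sweedler_comp[OF G] left right coproduct_tensor_power flip: sweedler_def)
qed

lemma sweedler_cocommutative:
  assumes "cocommutative \<Delta>" "bilinear B"
  shows "sweedler (\<lambda>u v. B v u) x = sweedler B x"
proof -
  have flip: "bilinear (\<lambda>u v. C v u)" if "bilinear C" for C :: "'a \<Rightarrow> 'a \<Rightarrow> 'c::real_vector"
    using that by (simp add: bilinear_def)
  have "sweedler B x = tensor_lift2 B (tensor_swap (\<Delta> x))"
    using assms(1) by (simp add: sweedler_def cocommutative_def)
  also have "\<dots> = tensor_lift2 B (sweedler (\<lambda>u v. pure_tensor [v, u]) x)"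
    by (simp add: tensor_swap_def sweedler_def)
  also have "\<dots> = sweedler (\<lambda>u v. tensor_lift2 B (pure_tensor [v, u])) x"
    by (rule sweedler_comp[OF linear_tensor_lift2[OF assms(2)] flip[OF bilinear_pure_tensor]])
  finally show ?thesis by (simp add: tensor_lift2_pure assms(2))
qed

section \<open>Primitive elements\<close>

lemma subspace_primitives: "subspace (primitives \<Delta>)"
proof -
  have "linear (\<lambda>x. pure_tensor [1, x] + pure_tensor [x, 1 :: 'a])"
    by (intro linear_compose_add linear_pure_tensor_2)
  from linear_compose_sub[OF linear_coproduct this] show ?thesis
    using linear_subspace_kernel by (fastforce simp: primitives_def)
qed

lemma coproduct_mult_primitives:
  assumes "x \<in> primitives \<Delta>" "y \<in> primitives \<Delta>"
  shows "\<Delta> (x * y) = pure_tensor [1, x * y] + pure_tensor [x, y] + pure_tensor [y, x] + pure_tensor [x * y, 1]"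
proof -
  have "bilinear (\<lambda>u v. pure_tensor [u, v * y])" "bilinear (\<lambda>u v. pure_tensor [u * y, v])"
    by (rule bilinear_comp[OF bilinear_pure_tensor linear_ident linear_mult_right[OF linear_ident]],
        rule bilinear_comp[OF bilinear_pure_tensor linear_mult_right[OF linear_ident] linear_ident])
  then show ?thesis
    by (simp add: coproduct_eq_sweedler sweedler_mult_primitive sweedler_primitive
       bilinear_pure_tensor assms algebra_simps)
qed

text \<open>The mixed terms in \<open>coproduct_mult_primitives\<close> are symmetric in
  \<open>x\<close> and \<open>y\<close>, so they cancel. This is what makes primitive factors
  commute up to shorter products.\<close>

lemma commutator_primitive:
  assumes "x \<in> primitives \<Delta>" "y \<in> primitives \<Delta>"
  shows "x * y - y * x \<in> primitives \<Delta>"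
  by (simp add: primitives_def linear_diff[OF linear_coproduct]
       coproduct_mult_primitives[OF assms] coproduct_mult_primitives[OF assms(2,1)]
       linear_diff[OF linear_pure_tensor_2(1)] linear_diff[OF linear_pure_tensor_2(2)] algebra_simps)

lemma counit_primitive: "p \<in> primitives \<Delta> \<Longrightarrow> \<epsilon> p = 0"
proof -
  assume p: "p \<in> primitives \<Delta>"
  have B: "bilinear (\<lambda>u v. \<epsilon> u *\<^sub>R (v :: 'a))"
    by (intro bilinearI linear_compose_scale_right linear_ident linear_scaleR_left linear_counit)
  have "p = sweedler (\<lambda>u v. \<epsilon> u *\<^sub>R v) p" by (simp add: sweedler_def counit_left)
  also have "\<dots> = p + \<epsilon> p *\<^sub>R 1" using p B by (simp add: sweedler_primitive counit_one)
  finally show "\<epsilon> p = 0" by simp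
qed

text \<open>The codomain is left general: maps into \<open>'a\<close> give the alternating products
  and \<open>adams\<close>, maps into the reals give the functionals of
  \<open>leading\<close>.\<close>

definition conv :: "('a \<Rightarrow> 'b::real_algebra_1) \<Rightarrow> ('a \<Rightarrow> 'b) \<Rightarrow> 'a \<Rightarrow> 'b" where
  "conv f g = sweedler (\<lambda>u v. f u * g v)"

lemma linear_conv: "linear f \<Longrightarrow> linear g \<Longrightarrow> linear (conv f g)"
  unfolding conv_def by (intro linear_sweedler bilinear_conv)

lemma linear_iterated_coproduct: "linear (iterated_coproduct \<Delta> (Suc n))"
proof (induction n)
  case 0
  then show ?case using linear_pure_tensor1 by (simp add: linear_iff)
next
  case (Suc n)
  have "linear (sweedler (\<lambda>u v. tensor_append (iterated_coproduct \<Delta> (Suc n) u) (pure_tensor [v])))"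
    by (rule linear_sweedler[OF bilinear_comp[OF bilinear_tensor_append Suc linear_pure_tensor1]])
  then show ?case by (simp add: linear_iff sweedler_def)
qed

definition conv_list :: "('a \<Rightarrow> 'a) list \<Rightarrow> 'a \<Rightarrow> 'a" where
  "conv_list fs x = tensor_mult (tensor_map fs (iterated_coproduct \<Delta> (length fs) x))"

lemma conv_list_singleton: "linear f \<Longrightarrow> conv_list [f] = f"
  by (simp add: conv_list_def fun_eq_iff tensor_map_pure tensor_mult_pure)

text \<open>The empty list is excluded because \<open>iterated_coproduct\<close> has the dummy value
  0 there, whereas the empty convolution would be given by the counit.\<close>

lemma conv_list_snoc:
  assumes "\<forall>f\<in>set fs. linear f" "linear g" "fs \<noteq> []"
  shows "conv_list (fs @ [g]) = conv (conv_list fs) g"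
proof
  fix x
  obtain n where n: "length fs = Suc n" using assms(3) by (cases fs) auto
  have lin: "\<forall>f \<in> set (fs @ [g]). linear f" using assms by auto
  have "conv_list (fs @ [g]) x = tensor_mult (tensor_map (fs @ [g])
      (sweedler (\<lambda>u v. tensor_append (iterated_coproduct \<Delta> (Suc n) u) (pure_tensor [v])) x))"
    by (simp add: conv_list_def n sweedler_def)
  also have "\<dots> = sweedler (\<lambda>u v. tensor_mult (tensor_map (fs @ [g])
      (tensor_append (iterated_coproduct \<Delta> (Suc n) u) (pure_tensor [v])))) x"
    by (rule sweedler_comp[OF linear_comp[OF linear_tensor_mult linear_tensor_map[OF lin]]
         bilinear_comp[OF bilinear_tensor_append linear_iterated_coproduct linear_pure_tensor1]])
  also have "\<dots> = conv (conv_list fs) g x"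
    by (simp add: tensor_mult_map_append assms conv_def conv_list_def n)
  finally show "conv_list (fs @ [g]) x = conv (conv_list fs) g x" .
qed

text \<open>Both \<open>tau_plus\<close> and \<open>tau_minus\<close> are instances, with the roles
  of \<open>id\<close> and \<open>\<tau>\<close> exchanged, so every computation is done
  once.\<close>

definition alternating :: "('a \<Rightarrow> 'a) \<Rightarrow> ('a \<Rightarrow> 'a) \<Rightarrow> nat \<Rightarrow> 'a \<Rightarrow> 'a" where
  "alternating f g n = conv_list (map (\<lambda>i. if even i then f else g) [0..<n])"

lemma tau_plus_eq: "tau_plus \<Delta> \<tau> a = alternating id \<tau> a"
  and tau_minus_eq: "tau_minus \<Delta> \<tau> a = alternating \<tau> id a"
  by (simp_all add: fun_eq_iff tau_plus_def tau_minus_def alternating_def conv_list_def)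

lemma alternating_1: "linear f \<Longrightarrow> alternating f g (Suc 0) = f"
  by (simp add: alternating_def conv_list_singleton)

lemma alternating_Suc:
  assumes "linear f" "linear g"
  shows "alternating f g (Suc (Suc n)) = conv (alternating f g (Suc n)) (if odd n then f else g)"
proof -
  have "alternating f g (Suc (Suc n)) = conv_list (map (\<lambda>i. if even i then f else g) [0..<Suc n] @ [if odd n then f else g])"
    by (simp add: alternating_def)
  also have "\<dots> = conv (alternating f g (Suc n)) (if odd n then f else g)"
    unfolding alternating_def using assms by (intro conv_list_snoc) auto
  finally show ?thesis .
qed

lemma linear_alternating:
  assumes "linear f" "linear g"
  shows "linear (alternating f g (Suc n))"
  by (induction n) (auto simp: alternating_1 alternating_Suc assms intro!: linear_conv)

text \<open>Writing \<open>s\<close> for the sign of \<open>q\<close> under the first factor, moving \<open>q\<close> through the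
  alternating product from both ends makes all inner terms cancel in pairs.\<close>

lemma alternating_anticommutator:
  assumes lin: "linear f" "linear g"
    and f: "\<And>x y. f (x * y) = f x * f y" and g: "\<And>x y. g (x * y) = g x * g y"
    and q: "q \<in> primitives \<Delta>" "f q = s *\<^sub>R q" "g q = - s *\<^sub>R q"
  shows "alternating f g (Suc n) (q * x + x * q) =
    s *\<^sub>R (q * alternating f g (Suc n) x) + ((-1) ^ n * s) *\<^sub>R (alternating f g (Suc n) x * q)"
proof (induction n arbitrary: x)
  case 0
  then show ?case by (simp add: alternating_1 lin f q linear_add)
next
  case (Suc n)
  let ?T = "alternating f g (Suc n)" and ?h = "if odd n then f else g"
  \<comment> \<open>The coefficient at the right end in the induction hypothesis. The next map acts
    on \<open>q\<close> by the opposite sign \<open>- c\<close>, as \<open>hq\<close>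
    records.\<close>
  define c where "c = (-1) ^ n * s"
  have T: "linear ?T" by (rule linear_alternating[OF lin])
  have h: "linear ?h" and hm: "?h (x * y) = ?h x * ?h y" and hq: "?h q = (- c) *\<^sub>R q" for x y
    using lin f g q by (auto simp: c_def)
  define h where "h = ?h"
  note h = h[folded h_def] and hm = hm[folded h_def] and hq = hq[folded h_def]
  have lq: "linear (\<lambda>x. q * x)" "linear (\<lambda>x. x * q)"
    by (intro linear_mult_left linear_mult_right linear_ident)+
  have b: "bilinear (\<lambda>u v. ?T u * h (v * q))" "bilinear (\<lambda>u v. ?T u * h (q * v))"
     "bilinear (\<lambda>u v. ?T (u * q) * h v)" "bilinear (\<lambda>u v. ?T (q * u) * h v)"
     "bilinear (\<lambda>u v. ?T u * h v)"
    using T h linear_comp[OF T lq(1)] linear_comp[OF T lq(2)] linear_comp[OF h lq(1)] linear_comp[OF h lq(2)]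
    by (auto intro!: bilinear_conv)
  have lin3: "linear (\<lambda>y. s *\<^sub>R (q * y) + (- c) *\<^sub>R (y * q))"
    by (intro linear_compose_add linear_compose_scale_right lq)
  have "conv ?T h (q * x + x * q) =
     sweedler (\<lambda>u v. ?T u * h (q * v)) x + sweedler (\<lambda>u v. ?T (q * u) * h v) x +
     (sweedler (\<lambda>u v. ?T u * h (v * q)) x + sweedler (\<lambda>u v. ?T (u * q) * h v) x)"
    unfolding conv_def
    by (simp only: linear_add[OF linear_sweedler[OF b(5)]] sweedler_primitive_mult[OF b(5) q(1)]
        sweedler_mult_primitive[OF b(5) q(1)])
  also have "\<dots> = sweedler (\<lambda>u v. (?T u * h (q * v) + ?T (q * u) * h v) + (?T u * h (v * q) + ?T (u * q) * h v)) x"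
    by (simp only: sweedler_add b bilinear_add)
  also have "(\<lambda>u v. (?T u * h (q * v) + ?T (q * u) * h v) + (?T u * h (v * q) + ?T (u * q) * h v)) =
     (\<lambda>u v. s *\<^sub>R (q * (?T u * h v)) + (- c) *\<^sub>R (?T u * h v * q))"
  proof (intro ext)
    fix u v
    have "(?T u * h (q * v) + ?T (q * u) * h v) + (?T u * h (v * q) + ?T (u * q) * h v) =
      ?T (q * u + u * q) * h v + ?T u * h (q * v) + ?T u * h (v * q)"
      by (simp add: linear_add[OF T] algebra_simps)
    \<comment> \<open>By the induction hypothesis \<open>?T (q * u + u * q)\<close> ends in
      \<open>c\<close> times \<open>?T u * q\<close>; multiplied by \<open>h v\<close> this cancels
      against \<open>?T u * h (q * v)\<close>.\<close>
    also have "\<dots> = s *\<^sub>R (q * (?T u * h v)) + (- c) *\<^sub>R (?T u * h v * q)"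
      by (simp add: Suc hm hq c_def algebra_simps)
    finally show "(?T u * h (q * v) + ?T (q * u) * h v) + (?T u * h (v * q) + ?T (u * q) * h v) =
      s *\<^sub>R (q * (?T u * h v)) + (- c) *\<^sub>R (?T u * h v * q)" .
  qed
  also have "sweedler (\<lambda>u v. s *\<^sub>R (q * (?T u * h v)) + (- c) *\<^sub>R (?T u * h v * q)) x =
     s *\<^sub>R (q * conv ?T h x) + (- c) *\<^sub>R (conv ?T h x * q)"
    unfolding conv_def by (rule sweedler_comp[OF lin3 b(5), symmetric])
  finally show ?case by (simp add: alternating_Suc lin h_def c_def)
qed

text \<open>The binomial theorem for \<open>\<Delta> (p ^ k)\<close>. With \<open>B\<close> and
  \<open>r\<close> arbitrary in the induction no binomial coefficients appear: absorbing
  \<open>p\<close> in one slot only rescales and shifts \<open>r\<close>.\<close>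

lemma sweedler_power:
  assumes "bilinear B" "p \<in> primitives \<Delta>"
    and "\<And>i j. B (p ^ i) (p ^ j) = (b ^ i * c ^ j) *\<^sub>R r (i + j)"
  shows "sweedler B (p ^ k) = (b + c) ^ k *\<^sub>R r k"
  using assms(1,3)
proof (induction k arbitrary: B r)
  case 0
  then show ?case using "0.prems"(2)[of 0 0] by (simp add: sweedler_one)
next
  case (Suc k)
  have B: "bilinear (\<lambda>u v. B u (v * p))" "bilinear (\<lambda>u v. B (u * p) v)"
    by (auto intro!: bilinear_comp[OF Suc.prems(1)] linear_ident linear_mult_right)
  have 1: "sweedler (\<lambda>u v. B u (v * p)) (p ^ k) = (b + c) ^ k *\<^sub>R (c *\<^sub>R r (Suc k))"
    by (rule Suc.IH[OF B(1), of "\<lambda>n. c *\<^sub>R r (Suc n)"])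
      (use Suc.prems(2)[of _ "Suc _"] in \<open>simp add: power_commutes mult_ac\<close>)
  have 2: "sweedler (\<lambda>u v. B (u * p) v) (p ^ k) = (b + c) ^ k *\<^sub>R (b *\<^sub>R r (Suc k))"
    by (rule Suc.IH[OF B(2), of "\<lambda>n. b *\<^sub>R r (Suc n)"])
      (use Suc.prems(2)[of "Suc _"] in \<open>simp add: power_commutes mult_ac\<close>)
  show ?case
    by (simp add: power_Suc2 sweedler_mult_primitive Suc.prems(1) assms(2) 1 2 algebra_simps del: power_Suc)
qed

text \<open>The bases of the eigenvalues add under convolution; \<open>a\<close> maps that fix the
  powers of \<open>p\<close> thus give the factor \<open>a ^ k\<close>.\<close>

lemma conv_power:
  assumes "p \<in> primitives \<Delta>" "linear f" "linear g"
    and "\<And>k. f (p ^ k) = b ^ k *\<^sub>R p ^ k" "\<And>k. g (p ^ k) = c ^ k *\<^sub>R p ^ k"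
  shows "conv f g (p ^ k) = (b + c) ^ k *\<^sub>R p ^ k"
  unfolding conv_def
  by (rule sweedler_power[where r = "\<lambda>n. p ^ n"])
    (auto simp: assms power_add intro!: bilinear_conv)

lemma alternating_power:
  assumes "p \<in> primitives \<Delta>" "linear f" "linear g"
    and "\<And>k. f (p ^ k) = p ^ k" "\<And>k. g (p ^ k) = p ^ k"
  shows "alternating f g (Suc n) (p ^ k) = real (Suc n) ^ k *\<^sub>R p ^ k"
proof (induction n arbitrary: k)
  case 0
  then show ?case by (simp add: alternating_1 assms)
next
  case (Suc n)
  have "conv (alternating f g (Suc n)) (if odd n then f else g) (p ^ k) = (real (Suc n) + 1) ^ k *\<^sub>R p ^ k"
    by (rule conv_power) (auto simp: assms Suc linear_alternating)
  then show ?case by (simp add: alternating_Suc assms add.commute)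
qed

end

section \<open>Polarization and symmetrized products\<close>

lemma power_sum_lists:
  fixes f :: "'i \<Rightarrow> 'a::semiring_1"
  assumes "finite A"
  shows "(\<Sum>i\<in>A. f i) ^ n = (\<Sum>xs | set xs \<subseteq> A \<and> length xs = n. prod_list (map f xs))"
proof (induction n)
  case 0
  have "{xs. set xs \<subseteq> A \<and> xs = []} = {[]}" by auto
  then show ?case by simp
next
  case (Suc n)
  let ?L = "{xs. set xs \<subseteq> A \<and> length xs = n}"
  have "(\<Sum>xs | set xs \<subseteq> A \<and> length xs = Suc n. prod_list (map f xs)) =
      (\<Sum>(xs, i)\<in>?L \<times> A. f i * prod_list (map f xs))"
    unfolding lists_length_Suc_eq
    by (subst sum.reindex) (auto simp: inj_on_def case_prod_unfold)
  also have "\<dots> = (\<Sum>i\<in>A. \<Sum>xs\<in>?L. f i * prod_list (map f xs))"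
    by (simp add: sum.cartesian_product[symmetric] sum.swap[of _ A])
  also have "\<dots> = (\<Sum>i\<in>A. f i) * (\<Sum>xs\<in>?L. prod_list (map f xs))"
    by (simp add: sum_product)
  finally show ?case by (simp add: Suc)
qed

text \<open>A permutation is read as the word of its values. Conversely, a word of length
  \<open>k\<close> in which all \<open>k\<close> indices occur has no repetition.\<close>

lemma sum_permutations_eq_sum_lists:
  "(\<Sum>\<sigma> | \<sigma> permutes {..<length ps}. prod_list (permute_list \<sigma> ps)) =
   (\<Sum>xs | set xs = {..<length ps} \<and> length xs = length ps. prod_list (map ((!) ps) xs))"
proof (rule sum.reindex_bij_witness)
  let ?k = "length ps"
  define \<pi> where "\<pi> xs i = (if i < ?k then xs ! i else i)" for xs i
  fix xs assume "xs \<in> {xs. set xs = {..<?k} \<and> length xs = ?k}"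
  then have xs: "set xs = {..<?k}" "length xs = ?k" by auto
  then have dist: "distinct xs" by (simp add: card_distinct)
  have "bij_betw (\<pi> xs) {..<?k} {..<?k}"
  proof (rule bij_betw_cong[THEN iffD1, rotated])
    show "bij_betw ((!) xs) {..<?k} {..<?k}"
      using xs by (intro bij_betw_nth[OF dist]) auto
  qed (simp add: \<pi>_def)
  then have "\<pi> xs permutes {..<?k}"
    by (rule bij_imp_permutes) (simp add: \<pi>_def)
  then show "\<pi> xs \<in> {\<sigma>. \<sigma> permutes {..<?k}}" by simp
  show "map (\<pi> xs) [0..<?k] = xs"
    using xs(2) by (intro nth_equalityI) (simp_all add: \<pi>_def)
next
  fix \<sigma> assume "\<sigma> \<in> {\<sigma>. \<sigma> permutes {..<length ps}}"
  then have \<sigma>: "\<sigma> permutes {..<length ps}" by simp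
  then show "(\<lambda>i. if i < length ps then map \<sigma> [0..<length ps] ! i else i) = \<sigma>"
    by (auto simp: fun_eq_iff permutes_def)
  show "map \<sigma> [0..<length ps] \<in> {xs. set xs = {..<length ps} \<and> length xs = length ps}"
    using permutes_image[OF \<sigma>] by (auto simp: atLeast0LessThan)
  show "prod_list (map ((!) ps) (map \<sigma> [0..<length ps])) = prod_list (permute_list \<sigma> ps)"
    by (simp add: permute_list_def comp_def)
qed

text \<open>Inclusion-exclusion over the set of indices in a word: a word in the expansion of the
  \<open>k\<close>-th powers is counted once for each \<open>T\<close> that contains all its
  indices, and only words using every index survive the signs.\<close>

lemma polarization:
  fixes ps :: "'a::real_algebra_1 list"
  defines "k \<equiv> length ps"
  shows "(\<Sum>\<sigma> | \<sigma> permutes {..<k}. prod_list (permute_list \<sigma> ps)) =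
    (\<Sum>T\<in>Pow {..<k}. (-1) ^ (k + card T) *\<^sub>R (\<Sum>i\<in>T. ps ! i) ^ k)"
proof -
  define L where "L = {xs. set xs \<subseteq> {..<k} \<and> length xs = k}"
  have finL: "finite L" unfolding L_def by (rule finite_lists_length_eq) simp
  \<comment> \<open>Of the sets between \<open>A\<close> and \<open>{..<k}\<close>, as many have
    even as odd cardinality, unless \<open>A\<close> is everything.\<close>
  have sign: "(\<Sum>T\<in>Pow {..<k}. if A \<subseteq> T then (-1) ^ (k + card T) else 0) = (if A = {..<k} then 1 else (0::real))"
    if "A \<subseteq> {..<k}" for A
  proof -
    have "(\<Sum>T\<in>Pow {..<k}. if A \<subseteq> T then (-1) ^ (k + card T) else (0::real)) =
        (-1) ^ k * (\<Sum>T | T \<subseteq> {..<k} \<and> A \<subseteq> T. (-1) ^ card T)"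
      by (simp add: sum.If_cases sum_distrib_left power_add Int_def Pow_def)
    also have "\<dots> = (if A = {..<k} then 1 else 0)"
    proof (cases "A = {..<k}")
      case True
      then have "{T. T \<subseteq> {..<k} \<and> A \<subseteq> T} = {{..<k}}" by auto
      then show ?thesis using True by (simp flip: power_add)
    next
      case False
      then have "A \<subset> {..<k}" using that by auto
      then have "(\<Sum>T | T \<subseteq> {..<k} \<and> A \<subseteq> T. (-1) ^ card T) = (0::real)"
        using card_subsupersets_even_odd[of "{..<k}" A]
        by (intro sum_alternating_cancels) (auto simp: conj_assoc)
      then show ?thesis using False by simp
    qed
    finally show ?thesis .
  qed
  have "(\<Sum>T\<in>Pow {..<k}. (-1) ^ (k + card T) *\<^sub>R (\<Sum>i\<in>T. ps ! i) ^ k) =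
      (\<Sum>T\<in>Pow {..<k}. \<Sum>xs\<in>L. (if set xs \<subseteq> T then (-1) ^ (k + card T) else 0) *\<^sub>R prod_list (map ((!) ps) xs))"
  proof (intro sum.cong refl)
    fix T assume "T \<in> Pow {..<k}"
    then have T: "T \<subseteq> {..<k}" "finite T" by (auto intro: finite_subset)
    have "{xs. set xs \<subseteq> T \<and> length xs = k} = {xs \<in> L. set xs \<subseteq> T}" using T by (auto simp: L_def)
    then show "(-1) ^ (k + card T) *\<^sub>R (\<Sum>i\<in>T. ps ! i) ^ k =
      (\<Sum>xs\<in>L. (if set xs \<subseteq> T then (-1) ^ (k + card T) else 0) *\<^sub>R prod_list (map ((!) ps) xs))"
      using finL by (simp add: power_sum_lists[OF T(2)] scaleR_sum_right sum.inter_filter)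
        (intro sum.cong, auto)
  qed
  also have "\<dots> = (\<Sum>xs\<in>L. (if set xs = {..<k} then 1 else 0) *\<^sub>R prod_list (map ((!) ps) xs))"
    by (subst sum.swap, intro sum.cong refl, unfold scaleR_sum_left[symmetric], subst sign)
      (auto simp: L_def)
  also have "\<dots> = (\<Sum>xs\<in>{xs \<in> L. set xs = {..<k}}. prod_list (map ((!) ps) xs))"
    using finL by (simp add: sum.inter_filter if_distribR if_distrib[of "\<lambda>c. c *\<^sub>R _"] cong: if_cong)
  also have "{xs \<in> L. set xs = {..<k}} = {xs. set xs = {..<length ps} \<and> length xs = length ps}"
    by (auto simp: k_def L_def)
  finally show ?thesis
    by (simp add: k_def sum_permutations_eq_sum_lists)
qed

lemma sum_permutations_in_span_powers:
  fixes ps :: "'a::real_algebra_1 list"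
  assumes "subspace V" "set ps \<subseteq> V"
  shows "(\<Sum>\<sigma> | \<sigma> permutes {..<length ps}. prod_list (permute_list \<sigma> ps)) \<in> span {p ^ length ps | p. p \<in> V}"
proof -
  have "(\<Sum>i\<in>T. ps ! i) ^ length ps \<in> span {p ^ length ps | p. p \<in> V}" if "T \<subseteq> {..<length ps}" for T
  proof -
    have "(\<Sum>i\<in>T. ps ! i) \<in> V"
      using assms(2) that by (intro subspace_sum[OF assms(1)]) (auto simp: subset_iff)
    then show ?thesis by (intro span_base) blast
  qed
  then show ?thesis
    unfolding polarization by (intro span_sum span_scale) auto
qed

section \<open>Recursion for symmetrized products\<close>

lemma symmetrized_product_Nil:
  "symmetrized_product ps [] = (\<Sum>\<sigma> | \<sigma> permutes {..<length ps}. prod_list (permute_list \<sigma> ps))"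
proof -
  have "set_compositions2 {..<0::nat} = {({}, {})}" by (auto simp: set_compositions2_def)
  then show ?thesis by (simp add: symmetrized_product_def permute_list_def)
qed

lemma sum_set_compositions2:
  "(\<Sum>(B1, B2) \<in> set_compositions2 A. f B1 B2) = (\<Sum>B\<in>Pow A. f B (A - B))"
  by (rule sum.reindex_bij_witness[of _ "\<lambda>B. (B, A - B)" fst])
    (auto simp: set_compositions2_def intro!: arg_cong2[where f = f])

lemma sorted_list_of_set_insert_greater:
  assumes "finite B" "\<And>b. b \<in> B \<Longrightarrow> b < (n::nat)"
  shows "sorted_list_of_set (insert n B) = sorted_list_of_set B @ [n]"
proof -
  have "n \<notin> B" using assms(2) by blast
  then have "sorted_list_of_set (insert n B) = insort n (sorted_list_of_set B)"
    using assms(1) by (simp add: Diff_triv)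
  also have "\<dots> = sorted_list_of_set B @ [n]"
    using assms by (intro sorted_insort_is_snoc) (auto simp: less_imp_le)
  finally show ?thesis .
qed

text \<open>The new index is the largest: it comes first in the decreasing product over
  \<open>B1\<close> or last in the increasing product over \<open>B2\<close>. This is the reason for
  the two opposite orders.\<close>

lemma symmetrized_product_snoc:
  "symmetrized_product ps (qs @ [q]) = q * symmetrized_product ps qs + symmetrized_product ps qs * q"
proof -
  let ?n = "length qs" and ?qs = "qs @ [q]"
  define M where "M = (\<Sum>\<sigma> | \<sigma> permutes {..<length ps}. prod_list (map (\<lambda>i. ps ! \<sigma> i) [0..<length ps]))"
  define g where "g xs C D = prod_list (map ((!) xs) (rev (sorted_list_of_set C))) * M *
      prod_list (map ((!) xs) (sorted_list_of_set D))" for xs C D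
  have S: "symmetrized_product ps xs = (\<Sum>B\<in>Pow {..<length xs}. g xs B ({..<length xs} - B))" for xs
    by (simp add: symmetrized_product_def M_def g_def sum_set_compositions2)
  have cong: "map ((!) ?qs) (sorted_list_of_set C) = map ((!) qs) (sorted_list_of_set C)"
    "map ((!) ?qs) (rev (sorted_list_of_set C)) = map ((!) qs) (rev (sorted_list_of_set C))"
    if "C \<subseteq> {..<?n}" for C
    using that finite_subset[OF that] by (auto simp: nth_append subset_iff)
  have ins: "sorted_list_of_set (insert ?n C) = sorted_list_of_set C @ [?n]" if "C \<subseteq> {..<?n}" for C
    using that finite_subset[OF that] by (intro sorted_list_of_set_insert_greater) auto
  have left: "g ?qs (insert ?n C) D = q * g qs C D" and right: "g ?qs C (insert ?n D) = g qs C D * q"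
    if "C \<subseteq> {..<?n}" "D \<subseteq> {..<?n}" for C D
    using that by (simp_all add: g_def ins cong mult.assoc)
  have diff: "insert ?n {..<?n} - insert ?n B = {..<?n} - B"
    "insert ?n {..<?n} - B = insert ?n ({..<?n} - B)" if "B \<subseteq> {..<?n}" for B
    using that by auto
  have inj: "inj_on (insert ?n) (Pow {..<?n})"
  proof (rule inj_onI)
    fix C D assume "C \<in> Pow {..<?n}" "D \<in> Pow {..<?n}" "insert ?n C = insert ?n D"
    moreover from this have "?n \<notin> C" "?n \<notin> D" by auto
    ultimately show "C = D" by (simp add: insert_ident)
  qed
  have "symmetrized_product ps ?qs = (\<Sum>B\<in>Pow (insert ?n {..<?n}). g ?qs B (insert ?n {..<?n} - B))"
    by (simp add: S lessThan_Suc)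
  also have "\<dots> = (\<Sum>B\<in>Pow {..<?n}. g ?qs B (insert ?n {..<?n} - B)) +
      (\<Sum>B\<in>insert ?n ` Pow {..<?n}. g ?qs B (insert ?n {..<?n} - B))"
    unfolding Pow_insert by (rule sum.union_disjoint) auto
  also have "(\<Sum>B\<in>Pow {..<?n}. g ?qs B (insert ?n {..<?n} - B)) = symmetrized_product ps qs * q"
    unfolding S sum_distrib_right by (intro sum.cong refl) (simp add: diff right)
  also have "(\<Sum>B\<in>insert ?n ` Pow {..<?n}. g ?qs B (insert ?n {..<?n} - B)) = q * symmetrized_product ps qs"
    unfolding S sum_distrib_left sum.reindex[OF inj] comp_def
    by (intro sum.cong refl) (use diff left in simp)
  finally show ?thesis by simp
qed

text \<open>Insertion sort for an order given as a relation on \<open>P\<close>.\<close>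

lemma sorted_permutation_exists:
  assumes "linear_order_on P r" "set xs \<subseteq> P"
  shows "\<exists>ys. mset ys = mset xs \<and> sorted_wrt (\<lambda>x y. (x, y) \<in> r) ys"
  using assms(2)
proof (induction xs)
  case Nil
  then show ?case by simp
next
  case (Cons x xs)
  then obtain ys where ys: "mset ys = mset xs" "sorted_wrt (\<lambda>x y. (x, y) \<in> r) ys" by auto
  have "trans r" "total_on P r" "refl_on P r"
    using assms(1) by (auto simp: order_on_defs)
  have "set ys \<subseteq> P" using ys(1) Cons.prems mset_eq_setD by fastforce
  with ys(2) have "\<exists>zs. mset zs = add_mset x (mset ys) \<and> sorted_wrt (\<lambda>x y. (x, y) \<in> r) zs"
  proof (induction ys)
    case Nil
    then show ?case by (intro exI[of _ "[x]"]) simp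
  next
    case (Cons y ys)
    show ?case
    proof (cases "(x, y) \<in> r")
      case True
      with Cons.prems \<open>trans r\<close> show ?thesis
        by (intro exI[of _ "x # y # ys"]) (auto dest: transD)
    next
      case False
      then have "(y, x) \<in> r"
        using \<open>total_on P r\<close> \<open>refl_on P r\<close> Cons.prems \<open>set (x # xs) \<subseteq> P\<close>
        by (cases "x = y") (auto simp: total_on_def refl_on_def)
      moreover obtain zs where zs: "mset zs = add_mset x (mset ys)" "sorted_wrt (\<lambda>x y. (x, y) \<in> r) zs"
        using Cons by auto
      moreover have "set zs = insert x (set ys)"
        using arg_cong[OF zs(1), of set_mset] by simp
      ultimately show ?thesis
        using Cons.prems by (intro exI[of _ "y # zs"]) auto
    qed
  qed
  then show ?case using ys by auto
qed

lemma sorted_permutation_unique: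
  assumes "antisym r" "sorted_wrt (\<lambda>x y. (x, y) \<in> r) xs" "sorted_wrt (\<lambda>x y. (x, y) \<in> r) ys"
    and "mset xs = mset ys"
  shows "xs = ys"
  using assms(2-4)
proof (induction xs arbitrary: ys)
  case Nil
  then show ?case by simp
next
  case (Cons x xs)
  then obtain y ys' where ys: "ys = y # ys'" by (cases ys) auto
  have "x = y"
  proof (rule ccontr)
    assume "x \<noteq> y"
    moreover have "x \<in> set (y # ys')" "y \<in> set (x # xs)"
      using Cons.prems(3) ys mset_eq_setD[OF Cons.prems(3)] by auto
    ultimately have "(x, y) \<in> r" "(y, x) \<in> r" using Cons.prems ys by auto
    then show False using \<open>antisym r\<close> \<open>x \<noteq> y\<close> by (auto dest: antisymD)
  qed
  then show ?case using Cons ys by auto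
qed

text \<open>Vandermonde without determinants: powers may be replaced by any polynomial in the nodes,
  in particular by one that vanishes at all nodes other than \<open>w e\<close>. The remaining nodes
  may coincide.\<close>

lemma power_sums_vanish:
  fixes w :: "'i \<Rightarrow> real" and d :: "'i \<Rightarrow> 'b::real_vector"
  assumes "finite E" and vanish: "\<And>s. (\<Sum>e\<in>E. w e ^ s *\<^sub>R d e) = 0"
    and e: "e \<in> E" "\<And>e'. e' \<in> E \<Longrightarrow> e' \<noteq> e \<Longrightarrow> w e' \<noteq> w e"
  shows "d e = 0"
proof -
  have poly: "(\<Sum>e\<in>E. poly p (w e) *\<^sub>R d e) = 0" for p
  proof -
    have "(\<Sum>e\<in>E. poly p (w e) *\<^sub>R d e) = (\<Sum>s\<le>degree p. coeff p s *\<^sub>R (\<Sum>e\<in>E. w e ^ s *\<^sub>R d e))"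
      by (simp add: poly_altdef scaleR_sum_left scaleR_sum_right sum.swap[of _ E])
    then show ?thesis by (simp add: vanish)
  qed
  define p where "p = (\<Prod>e'\<in>E - {e}. [:- w e', 1:])"
  have p: "poly p x = (\<Prod>e'\<in>E - {e}. x - w e')" for x
    by (simp add: p_def poly_prod)
  have "(\<Sum>e\<in>E. poly p (w e) *\<^sub>R d e) = poly p (w e) *\<^sub>R d e + (\<Sum>e\<in>E - {e}. poly p (w e) *\<^sub>R d e)"
    by (rule sum.remove[OF assms(1) e(1)])
  also have "(\<Sum>e\<in>E - {e}. poly p (w e) *\<^sub>R d e) = 0"
    using assms(1) by (intro sum.neutral ballI) (auto simp: p prod_zero_iff)
  finally have "poly p (w e) *\<^sub>R d e = 0" using poly by simp
  moreover have "poly p (w e) \<noteq> 0"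
    using assms(1) e(2)[symmetric] by (simp add: p prod_zero_iff)
  ultimately show ?thesis by simp
qed

lemma eigenvector_in_span_other_eigenvectors_zero:
  fixes T :: "'b::real_vector \<Rightarrow> 'b"
  assumes "linear T" "z \<in> span E" "\<And>e. e \<in> E \<Longrightarrow> T e = l e *\<^sub>R e" "\<And>e. e \<in> E \<Longrightarrow> l e \<noteq> \<mu>"
    and "T z = \<mu> *\<^sub>R z"
  shows "z = 0"
proof -
  obtain F c where F: "finite F" "F \<subseteq> E" "z = (\<Sum>e\<in>F. c e *\<^sub>R e)"
    using assms(2) by (auto simp: span_explicit)
  have pow: "\<mu> ^ s *\<^sub>R z = (\<Sum>e\<in>F. l e ^ s *\<^sub>R (c e *\<^sub>R e))" for s
  proof (induction s)
    case 0
    then show ?case by (simp add: F)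
  next
    case (Suc s)
    have "\<mu> ^ Suc s *\<^sub>R z = T (\<mu> ^ s *\<^sub>R z)"
      by (simp add: linear_scale[OF assms(1)] assms(5) mult.commute)
    also have "\<dots> = (\<Sum>e\<in>F. l e ^ Suc s *\<^sub>R (c e *\<^sub>R e))"
      using F(2) assms(3) unfolding Suc
      by (simp add: linear_sum[OF assms(1)] linear_scale[OF assms(1)])
        (intro sum.cong refl, auto simp: subset_iff mult_ac)
    finally show ?case .
  qed
  \<comment> \<open>\<open>None\<close> indexes \<open>- z\<close> with eigenvalue
    \<open>\<mu>\<close>. Only this node has to be isolated; coincidences among the eigenvalues in
    \<open>F\<close> are harmless.\<close>
  define w where "w i = (case i of None \<Rightarrow> \<mu> | Some e \<Rightarrow> l e)" for i
  define d where "d i = (case i of None \<Rightarrow> - z | Some e \<Rightarrow> c e *\<^sub>R e)" for i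
  have "d None = 0"
  proof (rule power_sums_vanish[where E = "insert None (Some ` F)" and w = w])
    show "(\<Sum>i\<in>insert None (Some ` F). w i ^ s *\<^sub>R d i) = 0" for s
      using F(1) by (subst sum.insert) (auto simp: w_def d_def sum.reindex pow)
  qed (use F assms(4) in \<open>auto simp: w_def\<close>)
  then show ?thesis by (simp add: d_def)
qed

section \<open>The filtration by products of primitive elements\<close>

lemma linear_image_span:
  assumes "linear f" "\<And>x. x \<in> A \<Longrightarrow> f x \<in> span C" "x \<in> span A"
  shows "f x \<in> span C"
  using assms(3)
proof (induction rule: span_induct_alt)
  case base
  then show ?case by (simp add: linear_0[OF assms(1)] span_zero)
next
  case (step c x y)
  then show ?case
    using assms(2) by (simp add: linear_add[OF assms(1)] linear_scale[OF assms(1)] span_add span_scale)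
qed

lemma bilinear_span:
  assumes "bilinear B" "\<And>x y. x \<in> A \<Longrightarrow> y \<in> C \<Longrightarrow> B x y \<in> span D" "x \<in> span A" "y \<in> span C"
  shows "B x y \<in> span D"
proof (rule linear_image_span[where f = "\<lambda>x. B x y", OF _ _ assms(3)])
  show "linear (\<lambda>x. B x y)" using assms(1) by (simp add: bilinear_def)
  fix x assume "x \<in> A"
  show "B x y \<in> span D"
    by (rule linear_image_span[where f = "B x", OF _ _ assms(4)])
      (use assms(1,2) \<open>x \<in> A\<close> in \<open>auto simp: bilinear_def\<close>)
qed

context graded_connected_hopf_algebra
begin

text \<open>The strict bound makes \<open>filt n\<close> the space of lower-order terms for products
  of \<open>n\<close> primitive elements, with \<open>filt 0\<close> zero as a start for
  inductions.\<close>

definition filt :: "nat \<Rightarrow> 'a set" where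
  "filt n = span {prod_list xs | xs. set xs \<subseteq> primitives \<Delta> \<and> length xs < n}"

lemma prod_list_in_filt: "set xs \<subseteq> primitives \<Delta> \<Longrightarrow> length xs < n \<Longrightarrow> prod_list xs \<in> filt n"
  unfolding filt_def by (intro span_base) auto

lemma filt_0: "filt 0 = {0}"
  by (simp add: filt_def)

lemma filt_mult_primitive:
  assumes "p \<in> primitives \<Delta>" "x \<in> filt n"
  shows "p * x \<in> filt (Suc n)" "x * p \<in> filt (Suc n)"
proof -
  have 1: "p * prod_list xs \<in> filt (Suc n)" "prod_list xs * p \<in> filt (Suc n)"
    if "set xs \<subseteq> primitives \<Delta>" "length xs < n" for xs
    using prod_list_in_filt[of "p # xs" "Suc n"] prod_list_in_filt[of "xs @ [p]" "Suc n"] that assms(1)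
    by auto
  show "p * x \<in> filt (Suc n)"
    unfolding filt_def
    by (rule linear_image_span[OF linear_mult_left[OF linear_ident] _ assms(2)[unfolded filt_def]])
      (use 1(1) in \<open>auto simp: filt_def\<close>)
  show "x * p \<in> filt (Suc n)"
    unfolding filt_def
    by (rule linear_image_span[OF linear_mult_right[OF linear_ident] _ assms(2)[unfolded filt_def]])
      (use 1(2) in \<open>auto simp: filt_def\<close>)
qed

text \<open>Each exchange of neighbours costs a product in which a commutator replaces two factors;
  the commutator is primitive, so this product is shorter by one.\<close>

lemma prod_list_move_primitive:
  assumes "x \<in> primitives \<Delta>" "set (as @ bs) \<subseteq> primitives \<Delta>"
  shows "x * prod_list (as @ bs) - prod_list (as @ x # bs) \<in> filt (Suc (length (as @ bs)))"
  using assms(2)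
proof (induction as)
  case Nil
  then show ?case by (simp add: filt_def span_zero)
next
  case (Cons a as)
  let ?R = "prod_list (as @ bs)"
  have "prod_list ((x * a - a * x) # as @ bs) \<in> filt (Suc (length ((a # as) @ bs)))"
    using Cons.prems assms(1) commutator_primitive[of x a] by (intro prod_list_in_filt) auto
  moreover have "a * (x * ?R - prod_list (as @ x # bs)) \<in> filt (Suc (length ((a # as) @ bs)))"
    using Cons filt_mult_primitive(1)[of a] by auto
  ultimately have "(x * a - a * x) * ?R + a * (x * ?R - prod_list (as @ x # bs)) \<in> filt (Suc (length ((a # as) @ bs)))"
    unfolding filt_def by (intro span_add) auto
  then show ?case by (simp add: algebra_simps)
qed

lemma prod_list_permute_primitives:
  assumes "mset xs = mset ys" "set xs \<subseteq> primitives \<Delta>"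
  shows "prod_list xs - prod_list ys \<in> filt (length xs)"
  using assms
proof (induction xs arbitrary: ys)
  case Nil
  then show ?case by (simp add: filt_0)
next
  case (Cons x xs)
  have "x \<in> set ys" using mset_eq_setD[OF Cons.prems(1)] by auto
  then obtain as bs where ys: "ys = as @ x # bs" by (auto simp: in_set_conv_decomp)
  then have m: "mset xs = mset (as @ bs)" using Cons.prems(1) by simp
  then have set: "set (as @ bs) \<subseteq> primitives \<Delta>" and len: "length (as @ bs) = length xs"
    using Cons.prems(2) mset_eq_setD[OF m] mset_eq_length[OF m] by auto
  have "x * (prod_list xs - prod_list (as @ bs)) \<in> filt (length (x # xs))"
    using filt_mult_primitive(1)[OF _ Cons.IH[OF m]] Cons.prems(2) by auto
  moreover have "x * prod_list (as @ bs) - prod_list ys \<in> filt (length (x # xs))"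
    using prod_list_move_primitive[OF _ set, of x] Cons.prems(2) len ys by simp
  ultimately have "x * (prod_list xs - prod_list (as @ bs)) + (x * prod_list (as @ bs) - prod_list ys) \<in> filt (length (x # xs))"
    unfolding filt_def by (intro span_add)
  then show ?case by (simp add: algebra_simps)
qed

lemma sum_permutations_leading_term:
  assumes "set ps \<subseteq> primitives \<Delta>"
  shows "(\<Sum>\<sigma> | \<sigma> permutes {..<length ps}. prod_list (permute_list \<sigma> ps)) - fact (length ps) *\<^sub>R prod_list ps
    \<in> filt (length ps)"
proof -
  have "(\<Sum>\<sigma> | \<sigma> permutes {..<length ps}. prod_list (permute_list \<sigma> ps) - prod_list ps) \<in> filt (length ps)"
    unfolding filt_def
  proof (rule span_sum)
    fix \<sigma> assume "\<sigma> \<in> {\<sigma>. \<sigma> permutes {..<length ps}}"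
    then have \<sigma>: "\<sigma> permutes {..<length ps}" by simp
    show "prod_list (permute_list \<sigma> ps) - prod_list ps \<in>
      span {prod_list xs | xs. set xs \<subseteq> primitives \<Delta> \<and> length xs < length ps}"
      using prod_list_permute_primitives[of "permute_list \<sigma> ps" ps] assms \<sigma>
      by (simp add: filt_def)
  qed
  also have "(\<Sum>\<sigma> | \<sigma> permutes {..<length ps}. prod_list (permute_list \<sigma> ps) - prod_list ps) =
    (\<Sum>\<sigma> | \<sigma> permutes {..<length ps}. prod_list (permute_list \<sigma> ps)) - fact (length ps) *\<^sub>R prod_list ps"
    by (simp add: sum_subtractf card_permutations[of "{..<length ps}" "length ps"] scaleR_conv_of_real)
  finally show ?thesis .
qed

text \<open>Modulo shorter products \<open>q * x + x * q\<close> is twice \<open>x * q\<close>, so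
  each barred element doubles the coefficient; the factorial counts the permutations.\<close>

lemma symmetrized_product_leading_term:
  assumes "set ps \<subseteq> primitives \<Delta>" "set qs \<subseteq> primitives \<Delta>"
  shows "symmetrized_product ps qs - (2 ^ length qs * fact (length ps)) *\<^sub>R prod_list (ps @ qs)
    \<in> filt (length (ps @ qs))"
  using assms(2)
proof (induction qs rule: rev_induct)
  case Nil
  then show ?case using sum_permutations_leading_term[OF assms(1)] by (simp add: symmetrized_product_Nil)
next
  case (snoc q qs)
  define c :: real where "c = 2 ^ length qs * fact (length ps)"
  define W where "W = symmetrized_product ps qs - c *\<^sub>R prod_list (ps @ qs)"
  have W: "W \<in> filt (length (ps @ qs))"
    using snoc by (simp add: W_def c_def)
  have q: "q \<in> primitives \<Delta>" using snoc by simp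
  have "prod_list (q # ps @ qs) - prod_list (ps @ qs @ [q]) \<in> filt (length (q # ps @ qs))"
    using snoc assms(1) by (intro prod_list_permute_primitives) auto
  moreover have "q * W \<in> filt (length (q # ps @ qs))" "W * q \<in> filt (length (q # ps @ qs))"
    using filt_mult_primitive[OF q W] by auto
  ultimately have "q * W + W * q + c *\<^sub>R (prod_list (q # ps @ qs) - prod_list (ps @ qs @ [q])) \<in> filt (length (q # ps @ qs))"
    unfolding filt_def by (intro span_add span_scale)
  also have "q * W + W * q + c *\<^sub>R (prod_list (q # ps @ qs) - prod_list (ps @ qs @ [q])) =
    symmetrized_product ps (qs @ [q]) - (2 * c) *\<^sub>R prod_list (ps @ qs @ [q])"
    by (simp add: W_def symmetrized_product_snoc algebra_simps scaleR_2 flip: scaleR_scaleR)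
  finally show ?case by (simp add: c_def mult.assoc)
qed

lemma symmetrized_product_in_filt:
  assumes "set ps \<subseteq> primitives \<Delta>" "set qs \<subseteq> primitives \<Delta>" "length ps + length qs < n"
  shows "symmetrized_product ps qs \<in> filt n"
proof -
  have "filt (length (ps @ qs)) \<subseteq> filt n"
    unfolding filt_def using assms(3) by (intro span_mono) auto
  then have 1: "symmetrized_product ps qs - (2 ^ length qs * fact (length ps)) *\<^sub>R prod_list (ps @ qs) \<in> filt n"
    using symmetrized_product_leading_term[OF assms(1,2)] by auto
  have "prod_list (ps @ qs) \<in> filt n"
    using assms by (intro prod_list_in_filt) auto
  then have "(2 ^ length qs * fact (length ps)) *\<^sub>R prod_list (ps @ qs) \<in> filt n"
    unfolding filt_def by (rule span_scale)
  from span_add[OF 1[unfolded filt_def] this[unfolded filt_def]] show ?thesis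
    by (simp add: filt_def)
qed

text \<open>\<open>leading \<phi> m f c\<close> says that \<open>f\<close> behaves like \<open>c\<close> times the \<open>m\<close>-th convolution
  power of \<open>\<phi>\<close> on products of at most \<open>m\<close> primitive elements.\<close>

definition leading :: "('a \<Rightarrow> real) \<Rightarrow> nat \<Rightarrow> ('a \<Rightarrow> real) \<Rightarrow> real \<Rightarrow> bool" where
  "leading \<phi> m f c \<longleftrightarrow> linear f \<and>
     (\<forall>xs. set xs \<subseteq> primitives \<Delta> \<longrightarrow> length xs < m \<longrightarrow> f (prod_list xs) = 0) \<and>
     (\<forall>xs. set xs \<subseteq> primitives \<Delta> \<longrightarrow> length xs = m \<longrightarrow> f (prod_list xs) = c * fact m * prod_list (map \<phi> xs))"

lemma leadingD:
  assumes "leading \<phi> m f c"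
  shows "linear f"
    and "set xs \<subseteq> primitives \<Delta> \<Longrightarrow> length xs < m \<Longrightarrow> f (prod_list xs) = 0"
    and "set xs \<subseteq> primitives \<Delta> \<Longrightarrow> length xs = m \<Longrightarrow> f (prod_list xs) = c * fact m * prod_list (map \<phi> xs)"
  using assms by (simp_all add: leading_def)

lemma conv_mult_primitive:
  assumes "linear f" "linear g" "p \<in> primitives \<Delta>"
  shows "conv f g (x * p) = conv f (\<lambda>v. g (v * p)) x + conv (\<lambda>u. f (u * p)) g x"
  unfolding conv_def using assms by (intro sweedler_mult_primitive bilinear_conv)

text \<open>Pigeonhole: with fewer than \<open>m + n\<close> factors, one slot receives too few. In
  the induction the last factor is absorbed into \<open>f\<close> or \<open>g\<close>, which lowers
  the corresponding bound by one.\<close>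

lemma conv_vanishes:
  fixes f g :: "'a \<Rightarrow> real"
  assumes "linear f" "linear g"
    and "\<And>ys. set ys \<subseteq> primitives \<Delta> \<Longrightarrow> length ys < m \<Longrightarrow> f (prod_list ys) = 0"
    and "\<And>ys. set ys \<subseteq> primitives \<Delta> \<Longrightarrow> length ys < n \<Longrightarrow> g (prod_list ys) = 0"
    and "set xs \<subseteq> primitives \<Delta>" "length xs < m + n"
  shows "conv f g (prod_list xs) = 0"
  using assms
proof (induction xs arbitrary: f g m n rule: rev_induct)
  case Nil
  have "f 1 = 0 \<or> g 1 = 0"
    using Nil.prems(3)[of "[]"] Nil.prems(4)[of "[]"] Nil.prems(6) by auto
  then show ?case using Nil.prems by (auto simp: conv_def sweedler_one bilinear_conv)
next
  case (snoc p xs)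
  have p: "p \<in> primitives \<Delta>" "set xs \<subseteq> primitives \<Delta>" using snoc.prems by auto
  have lin: "linear (\<lambda>v. h (v * p))" if "linear h" for h :: "'a \<Rightarrow> real"
    by (rule linear_comp[OF that linear_mult_right[OF linear_ident]])
  have "conv f (\<lambda>v. g (v * p)) (prod_list xs) = 0"
  \<comment> \<open>For \<open>n = 0\<close> the truncated \<open>n - 1\<close> is again 0 and the
    condition on \<open>g\<close> is void.\<close>
  proof (rule snoc.IH[of f "\<lambda>v. g (v * p)" m "n - 1"])
    show "g (prod_list ys * p) = 0" if "set ys \<subseteq> primitives \<Delta>" "length ys < n - 1" for ys
      using snoc.prems(4)[of "ys @ [p]"] that p by auto
  qed (use snoc.prems p lin in auto)
  moreover have "conv (\<lambda>v. f (v * p)) g (prod_list xs) = 0"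
  proof (rule snoc.IH[of "\<lambda>v. f (v * p)" g "m - 1" n])
    show "f (prod_list ys * p) = 0" if "set ys \<subseteq> primitives \<Delta>" "length ys < m - 1" for ys
      using snoc.prems(3)[of "ys @ [p]"] that p by auto
  qed (use snoc.prems p lin in auto)
  ultimately show ?case
    using snoc.prems p by (simp add: conv_mult_primitive)
qed

text \<open>Fixing the last factor takes \<open>real (Suc m)\<close> out of the factorial and
  \<open>\<phi> p\<close> out of the product; both go into the constant.\<close>

lemma leading_shift:
  assumes "leading \<phi> (Suc m) f c" "p \<in> primitives \<Delta>"
  shows "leading \<phi> m (\<lambda>v. f (v * p)) (c * real (Suc m) * \<phi> p)"
proof -
  have f: "linear f" "\<And>xs. set xs \<subseteq> primitives \<Delta> \<Longrightarrow> length xs < Suc m \<Longrightarrow> f (prod_list xs) = 0"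
    "\<And>xs. set xs \<subseteq> primitives \<Delta> \<Longrightarrow> length xs = Suc m \<Longrightarrow> f (prod_list xs) = c * fact (Suc m) * prod_list (map \<phi> xs)"
    using assms(1) by (auto simp: leading_def)
  have "linear (\<lambda>v. f (v * p))"
    by (rule linear_comp[OF f(1) linear_mult_right[OF linear_ident]])
  moreover have "f (prod_list xs * p) = 0" if "set xs \<subseteq> primitives \<Delta>" "length xs < m" for xs
    using f(2)[of "xs @ [p]"] that assms(2) by auto
  moreover have "f (prod_list xs * p) = c * real (Suc m) * \<phi> p * fact m * prod_list (map \<phi> xs)"
    if "set xs \<subseteq> primitives \<Delta>" "length xs = m" for xs
    using f(3)[of "xs @ [p]"] that assms(2) by (auto simp: algebra_simps)
  ultimately show ?thesis by (auto simp: leading_def)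
qed

text \<open>The constants must be arbitrary since \<open>leading_shift\<close> changes them. The
  last factor goes to \<open>f\<close> with weight \<open>m\<close> or to \<open>g\<close> with
  weight \<open>n\<close>, and the weights add up to the new factor of
  \<open>fact (m + n)\<close>.\<close>

lemma leading_conv:
  assumes "leading \<phi> m f c" "leading \<phi> n g d"
  shows "leading \<phi> (m + n) (conv f g) (c * d)"
proof -
  have vanish: "conv f g (prod_list xs) = 0"
    if "leading \<phi> m f c" "leading \<phi> n g d" "set xs \<subseteq> primitives \<Delta>" "length xs < m + n" for xs m n f g c d
    using that by (intro conv_vanishes[where m = m and n = n]) (auto dest: leadingD)
  have "conv f g (prod_list xs) = c * d * fact (m + n) * prod_list (map \<phi> xs)"
    if "set xs \<subseteq> primitives \<Delta>" "length xs = m + n" for xs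
    using assms that
  proof (induction xs arbitrary: f g m n c d rule: rev_induct)
    case Nil
    then have "f 1 = c" "g 1 = d"
      using leadingD(3)[OF Nil(1), of "[]"] leadingD(3)[OF Nil(2), of "[]"] by auto
    moreover have "linear f" "linear g" using Nil leadingD(1) by blast+
    ultimately show ?case using Nil(4) by (simp add: conv_def sweedler_one bilinear_conv)
  next
    case (snoc p xs)
    have p: "p \<in> primitives \<Delta>" "set xs \<subseteq> primitives \<Delta>" using snoc.prems by auto
    have lin: "linear f" "linear g" using snoc.prems leadingD(1) by blast+
    have lin': "linear (\<lambda>v. h (v * p))" if "linear h" for h :: "'a \<Rightarrow> real"
      by (rule linear_comp[OF that linear_mult_right[OF linear_ident]])
    let ?F = "fact (length xs) * c * d * \<phi> p * prod_list (map \<phi> xs)"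
    have 1: "conv (\<lambda>v. f (v * p)) g (prod_list xs) = real m * ?F"
    proof (cases m)
      case 0
      \<comment> \<open>After \<open>p\<close> is absorbed by \<open>f\<close>, fewer than
        \<open>n\<close> factors remain for \<open>g\<close>.\<close>
      have "conv (\<lambda>v. f (v * p)) g (prod_list xs) = 0"
        by (rule conv_vanishes[where m = 0 and n = n]) (use snoc.prems p lin lin' 0 leadingD(2) in auto)
      then show ?thesis by (simp add: 0)
    next
      case (Suc m')
      show ?thesis
        using snoc.IH[OF leading_shift[OF snoc.prems(1)[unfolded Suc] p(1)] snoc.prems(2) p(2)] snoc.prems(4) Suc
        by (simp add: mult_ac)
    qed
    have 2: "conv f (\<lambda>v. g (v * p)) (prod_list xs) = real n * ?F"
    proof (cases n)
      case 0
      have "conv f (\<lambda>v. g (v * p)) (prod_list xs) = 0"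
        by (rule conv_vanishes[where m = m and n = 0]) (use snoc.prems p lin lin' 0 leadingD(2) in auto)
      then show ?thesis by (simp add: 0)
    next
      case (Suc n')
      show ?thesis
        using snoc.IH[OF snoc.prems(1) leading_shift[OF snoc.prems(2)[unfolded Suc] p(1)] p(2)] snoc.prems(4) Suc
        by (simp add: mult_ac)
    qed
    have "fact (m + n) = real (m + n) * fact (length xs)"
      using snoc.prems(4) by (metis fact_Suc length_append_singleton of_nat_mult of_nat_fact)
    then show ?case
      using p lin by (simp add: conv_mult_primitive 1 2 algebra_simps)
  qed
  then show ?thesis
    using vanish[OF assms] assms by (auto simp: leading_def linear_conv)
qed

text \<open>The zeroth convolution power is the counit; each step convolves with
  \<open>\<phi>\<close>, which vanishes on the empty product by \<open>\<phi> 1 = 0\<close>.\<close>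

lemma leading_functional_exists:
  fixes \<phi> :: "'a \<Rightarrow> real"
  assumes "linear \<phi>" "\<phi> 1 = 0"
  shows "\<exists>\<Phi>. leading \<phi> n \<Phi> 1"
proof (induction n)
  case 0
  have "leading \<phi> 0 \<epsilon> 1" by (auto simp: leading_def linear_counit counit_one)
  then show ?case by blast
next
  case (Suc n)
  then obtain \<Phi> where "leading \<phi> n \<Phi> 1" by blast
  moreover have "leading \<phi> 1 \<phi> 1" using assms by (auto simp: leading_def length_Suc_conv)
  ultimately have "leading \<phi> (n + 1) (conv \<Phi> \<phi>) (1 * 1)" by (rule leading_conv)
  then show ?case by auto
qed

lemma leading_vanishes_on_filt:
  assumes "leading \<phi> n \<Phi> c" "x \<in> filt n"
  shows "\<Phi> x = 0"
  by (rule linear_eq_0_on_span[OF leadingD(1)[OF assms(1)] _ assms(2)[unfolded filt_def]])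
    (use leadingD(2)[OF assms(1)] in auto)

lemma leading_symmetrized_product:
  assumes "leading \<phi> (length ps + length qs) \<Phi> 1" "set ps \<subseteq> primitives \<Delta>" "set qs \<subseteq> primitives \<Delta>"
  shows "\<Phi> (symmetrized_product ps qs) =
    2 ^ length qs * fact (length ps) * fact (length ps + length qs) * prod_list (map \<phi> (ps @ qs))"
proof -
  have lin: "linear \<Phi>" by (rule leadingD(1)[OF assms(1)])
  have "\<Phi> (symmetrized_product ps qs - (2 ^ length qs * fact (length ps)) *\<^sub>R prod_list (ps @ qs)) = 0"
    using leading_vanishes_on_filt[OF assms(1)] symmetrized_product_leading_term[OF assms(2,3)] by simp
  moreover have "\<Phi> (prod_list (ps @ qs)) = 1 * fact (length ps + length qs) * prod_list (map \<phi> (ps @ qs))"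
    using assms by (intro leadingD(3)) auto
  ultimately show ?thesis by (simp add: linear_diff[OF lin] linear_scale[OF lin])
qed

section \<open>Separating functionals and linear independence\<close>

lemma one_notin_span_primitives: "A \<subseteq> primitives \<Delta> \<Longrightarrow> 1 \<notin> span A"
  using span_minimal[OF _ subspace_primitives, of A] counit_primitive counit_one by fastforce

text \<open>Finitely many hyperplanes do not cover the dual: a functional good for \<open>X\<close>
  is perturbed by a generic multiple of one that does not vanish at \<open>y\<close>.\<close>

lemma separating_functional:
  assumes "finite X" "X \<subseteq> primitives \<Delta> - {0}"
  shows "\<exists>\<phi>. linear \<phi> \<and> \<phi> 1 = (0::real) \<and> (\<forall>x\<in>X. \<phi> x \<noteq> 0)"
  using assms
proof (induction X rule: finite_induct)
  case empty
  then show ?case by (intro exI[of _ "\<lambda>_. 0"]) (simp add: linear_zero)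
next
  case (insert y X)
  then obtain \<phi> where \<phi>: "linear \<phi>" "\<phi> 1 = (0::real)" "\<forall>x\<in>X. \<phi> x \<noteq> 0" by auto
  have "1 \<notin> span {y}" using insert one_notin_span_primitives[of "{y}"] by auto
  then have "independent {1, y}" "y \<noteq> 1"
    using insert by (auto simp: independent_insert span_base)
  then obtain \<psi> where \<psi>: "linear \<psi>" "\<forall>x\<in>{1, y}. \<psi> x = (if x = y then 1 else 0 :: real)"
    using linear_independent_extend[of "{1, y}" "\<lambda>x. if x = y then 1 else 0 :: real"] by blast
  have "infinite (UNIV :: real set)" by (rule infinite_UNIV_char_0)
  moreover have "finite (insert (- \<phi> y) ((\<lambda>x. - \<phi> x / \<psi> x) ` X))" using insert by auto
  \<comment> \<open>The excluded values include every zero of \<open>\<phi> x + c * \<psi> x\<close>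
    in \<open>c\<close>; at \<open>y\<close> this is \<open>- \<phi> y\<close> as
    \<open>\<psi> y = 1\<close>.\<close>
  ultimately obtain c where c: "c \<notin> insert (- \<phi> y) ((\<lambda>x. - \<phi> x / \<psi> x) ` X)"
    using ex_new_if_finite by blast
  have "\<phi> x + c * \<psi> x \<noteq> 0" if "x \<in> insert y X" for x
  proof (cases "\<psi> x = 0")
    case True
    then show ?thesis using \<psi> \<phi> that by auto
  next
    case False
    show ?thesis
    proof
      assume "\<phi> x + c * \<psi> x = 0"
      then have "c = - \<phi> x / \<psi> x" using False by (simp add: field_simps)
      then show False using c that \<psi> by auto
    qed
  qed
  moreover have "linear (\<lambda>x. \<phi> x + c * \<psi> x)"
    by (intro linear_compose_add linear_mult_left \<phi> \<psi>)
  ultimately show ?case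
    using \<phi> \<psi> \<open>y \<noteq> 1\<close> by (intro exI[of _ "\<lambda>x. \<phi> x + c * \<psi> x"]) auto
qed

text \<open>A leading functional moves the claim into the reals, where a product of nonzero numbers
  is nonzero.\<close>

lemma symmetrized_product_nonzero:
  assumes "set ps \<subseteq> primitives \<Delta>" "set qs \<subseteq> primitives \<Delta>" "0 \<notin> set ps \<union> set qs"
  shows "symmetrized_product ps qs \<noteq> 0"
proof
  assume 0: "symmetrized_product ps qs = 0"
  have "set ps \<union> set qs \<subseteq> primitives \<Delta> - {0}" using assms by auto
  then obtain \<phi> where \<phi>: "linear \<phi>" "\<phi> 1 = (0::real)" "\<forall>x\<in>set ps \<union> set qs. \<phi> x \<noteq> 0"
    using separating_functional[of "set ps \<union> set qs"] by blast
  obtain \<Phi> where \<Phi>: "leading \<phi> (length ps + length qs) \<Phi> 1"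
    using leading_functional_exists[OF \<phi>(1,2)] by blast
  have "\<Phi> 0 = 0" by (rule linear_0[OF leadingD(1)[OF \<Phi>]])
  then have "prod_list (map \<phi> (ps @ qs)) = 0"
    using leading_symmetrized_product[OF \<Phi> assms(1,2)] 0 by simp
  then have "0 \<in> \<phi> ` (set ps \<union> set qs)"
    unfolding prod_list_zero_iff by auto
  then show False using \<phi>(3) by auto
qed

text \<open>Sending the basis elements to \<open>s\<close>-th powers of distinct primes turns distinct
  monomials into \<open>s\<close>-th powers of distinct integers, so the coefficients of a
  top-degree relation are killed by a Vandermonde argument.\<close>

lemma symmetrized_products_independent:
  assumes B: "independent B" "B \<subseteq> primitives \<Delta>"
    and J: "finite J" "\<And>ps qs. (ps, qs) \<in> J \<Longrightarrow> set ps \<union> set qs \<subseteq> B"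
    and inj: "inj_on (\<lambda>(ps, qs). mset (ps @ qs)) J"
    and sum0: "(\<Sum>j\<in>J. c j *\<^sub>R (case j of (ps, qs) \<Rightarrow> symmetrized_product ps qs)) = 0"
    and "j \<in> J"
  shows "c j = 0"
proof (rule ccontr)
  assume "c j \<noteq> 0"
  define len where "len = (\<lambda>(ps :: 'a list, qs :: 'a list). length ps + length qs)"
  define J' where "J' = {j \<in> J. c j \<noteq> 0}"
  \<comment> \<open>Only indices of maximal length with nonzero coefficient enter the final sum: the
    leading functional for \<open>n\<close> kills the shorter vectors.\<close>
  define n where "n = Max (len ` J')"
  define K where "K = {j \<in> J'. len j = n}"
  have fin: "finite J'" "finite K" using J by (auto simp: J'_def K_def)
  have "j \<in> J'" using \<open>j \<in> J\<close> \<open>c j \<noteq> 0\<close> by (simp add: J'_def)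
  then have "n \<in> len ` J'" unfolding n_def using fin by (intro Max_in) auto
  then obtain k where k: "k \<in> K" by (auto simp: K_def)
  have le: "len j \<le> n" if "j \<in> J'" for j unfolding n_def using that fin by auto
  define B0 where "B0 = (\<Union>(ps, qs)\<in>J. set ps \<union> set qs)"
  have B0: "finite B0" "B0 \<subseteq> B" using J by (auto simp: B0_def)
  have J_B0: "set ps \<union> set qs \<subseteq> B0" if "(ps, qs) \<in> J" for ps qs
    using that by (auto simp: B0_def)
  obtain Pr where Pr: "Pr \<subseteq> {p::nat. prime p}" "finite Pr" "card Pr = card B0"
    using infinite_arbitrarily_large[OF primes_infinite] by metis
  obtain g where g: "g ` B0 \<subseteq> Pr" "inj_on g B0"
    using card_le_inj[OF B0(1) Pr(2)] Pr(3) by auto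
  define w where "w j = real (prod_mset (image_mset g (case j of (ps, qs) \<Rightarrow> mset (ps @ qs))))" for j
  define d where "d j = c j * (case j of (ps, qs) \<Rightarrow> 2 ^ length qs * fact (length ps)) * fact n" for j
  \<comment> \<open>Lets a functional vanish at 1 and take prescribed values on
    \<open>B\<close>.\<close>
  have ind: "independent (insert 1 B)"
    using B one_notin_span_primitives by (simp add: independent_insertI)
  have "(\<Sum>j\<in>K. w j ^ s *\<^sub>R d j) = 0" for s
  proof -
    obtain \<phi> where \<phi>: "linear \<phi>" "\<forall>x\<in>insert 1 B. \<phi> x = (if x = 1 then 0 else real (g x) ^ s)"
      using linear_independent_extend[OF ind, of "\<lambda>x. if x = 1 then 0 else real (g x) ^ s"] by blast
    have \<phi>1: "\<phi> 1 = 0" using \<phi> by simp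
    have "1 \<notin> B" using one_notin_span_primitives[OF B(2)] span_base by blast
    then have \<phi>B: "\<phi> x = real (g x) ^ s" if "x \<in> B" for x using \<phi>(2) that by auto
    obtain \<Phi> where \<Phi>: "leading \<phi> n \<Phi> 1"
      using leading_functional_exists[OF \<phi>(1) \<phi>1] by blast
    have lin: "linear \<Phi>" by (rule leadingD(1)[OF \<Phi>])
    have "0 = \<Phi> (\<Sum>j\<in>J. c j *\<^sub>R (case j of (ps, qs) \<Rightarrow> symmetrized_product ps qs))"
      by (simp add: sum0 linear_0[OF lin])
    also have "\<dots> = (\<Sum>j\<in>J. c j * \<Phi> (case j of (ps, qs) \<Rightarrow> symmetrized_product ps qs))"
      by (simp add: linear_sum[OF lin] linear_scale[OF lin])
    also have "\<dots> = (\<Sum>j\<in>K. c j * \<Phi> (case j of (ps, qs) \<Rightarrow> symmetrized_product ps qs))"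
    proof (rule sum.mono_neutral_right)
      show "\<forall>j\<in>J - K. c j * \<Phi> (case j of (ps, qs) \<Rightarrow> symmetrized_product ps qs) = 0"
      proof
        fix j assume j: "j \<in> J - K"
        obtain ps qs where pq: "j = (ps, qs)" by (cases j)
        show "c j * \<Phi> (case j of (ps, qs) \<Rightarrow> symmetrized_product ps qs) = 0"
        proof (cases "c j = 0")
          case False
          then have "len j < n" using j le[of j] by (auto simp: K_def J'_def le_less)
          then have "symmetrized_product ps qs \<in> filt n"
            using J(2)[of ps qs] j B(2) pq by (intro symmetrized_product_in_filt) (auto simp: len_def)
          then show ?thesis using leading_vanishes_on_filt[OF \<Phi>] by (simp add: pq)
        qed simp
      qed
    qed (use J in \<open>auto simp: K_def J'_def\<close>)
    also have "\<dots> = (\<Sum>j\<in>K. w j ^ s *\<^sub>R d j)"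
    proof (intro sum.cong refl)
      fix j assume j: "j \<in> K"
      obtain ps qs where pq: "j = (ps, qs)" by (cases j)
      have n: "n = length ps + length qs" and J': "(ps, qs) \<in> J"
        using j by (auto simp: K_def J'_def len_def pq)
      have set: "set ps \<subseteq> B" "set qs \<subseteq> B" using J(2)[OF J'] by auto
      have "prod_list (map \<phi> xs) = w' ^ s" if "set xs \<subseteq> B" "w' = real (prod_mset (image_mset g (mset xs)))" for xs w'
        using that by (induction xs arbitrary: w') (auto simp: \<phi>B power_mult_distrib)
      from this[of "ps @ qs" "w j"] have "prod_list (map \<phi> (ps @ qs)) = w j ^ s"
        using set by (simp add: w_def pq)
      then show "c j * \<Phi> (case j of (ps, qs) \<Rightarrow> symmetrized_product ps qs) = w j ^ s *\<^sub>R d j"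
        using leading_symmetrized_product[OF \<Phi>[unfolded n]] set B(2)
        by (simp add: pq d_def n mult_ac)
    qed
    finally show ?thesis by simp
  qed
  moreover have "w j \<noteq> w k" if "j \<in> K" "j \<noteq> k" for j
  proof
    assume eq: "w j = w k"
    define M where "M j = (case j of (ps, qs) \<Rightarrow> mset (ps @ qs :: 'a list))" for j
    have jk: "j \<in> J" "k \<in> J" using that k by (auto simp: K_def J'_def)
    have sub: "set_mset (M i) \<subseteq> B0" if "i \<in> J" for i
      using that J_B0 by (auto simp: M_def split: prod.splits)
    \<comment> \<open>Unique factorization: the integer behind \<open>w\<close> determines the
      multiset of primes, and \<open>g\<close> assigns distinct primes to distinct basis
      elements.\<close>
    have pf: "prime_factorization (prod_mset (image_mset g (M i))) = image_mset g (M i)" if "i \<in> J" for i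
      using sub[OF that] g(1) Pr(1) by (intro prime_factorization_prod_mset_primes) auto
    have "prod_mset (image_mset g (M j)) = prod_mset (image_mset g (M k))"
      using eq by (simp add: w_def M_def)
    then have "image_mset g (M j) = image_mset g (M k)"
      using pf jk by metis
    then have "M j = M k"
      using sub[OF jk(1)] sub[OF jk(2)] inj_onD[OF g(2)]
      by (intro multiset.inj_map_strong[of "M j" "M k" g g]) auto
    then have "j = k" using inj jk by (auto simp: inj_on_def M_def case_prod_unfold)
    then show False using that by simp
  qed
  ultimately have "d k = 0" using power_sums_vanish[OF fin(2), of w d k] k by blast
  then show False using k by (auto simp: d_def K_def J'_def split: prod.splits)
qed

text \<open>By induction on \<open>n\<close>: a product of \<open>n\<close> primitive elements is
  expanded in \<open>P \<union> Q\<close>, sorted modulo shorter products, and divided by the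
  coefficient of the leading term, which is not zero.\<close>

lemma filt_subset_span_symmetrized_products:
  assumes B: "primitives \<Delta> = span (P \<union> Q)"
    and r: "linear_order_on P r" and s: "linear_order_on Q s"
  shows "filt n \<subseteq> span ((\<lambda>(ps, qs). symmetrized_product ps qs) ` (sorted_lists_over P r \<times> sorted_lists_over Q s))"
    (is "_ \<subseteq> span ?V")
proof (induction n)
  case 0
  then show ?case by (simp add: filt_0 span_zero)
next
  case (Suc n)
  have PQ: "P \<union> Q \<subseteq> primitives \<Delta>" using B span_superset by blast
  have basis: "prod_list bs \<in> span ?V" if bs: "set bs \<subseteq> P \<union> Q" "length bs = n" for bs
  proof -
    obtain ps where ps: "mset ps = mset (filter (\<lambda>b. b \<in> P) bs)" "sorted_wrt (\<lambda>x y. (x, y) \<in> r) ps"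
      using sorted_permutation_exists[OF r, of "filter (\<lambda>b. b \<in> P) bs"] by auto
    obtain qs where qs: "mset qs = mset (filter (\<lambda>b. b \<notin> P) bs)" "sorted_wrt (\<lambda>x y. (x, y) \<in> s) qs"
      using sorted_permutation_exists[OF s, of "filter (\<lambda>b. b \<notin> P) bs"] bs by auto
    have set: "set ps \<subseteq> P" "set qs \<subseteq> Q"
      using mset_eq_setD[OF ps(1)] mset_eq_setD[OF qs(1)] bs by auto
    have m: "mset bs = mset (ps @ qs)" by (simp add: ps(1) qs(1))
    then have len: "length (ps @ qs) = n" using bs mset_eq_length by metis
    define c :: real where "c = 2 ^ length qs * fact (length ps)"
    have "symmetrized_product ps qs \<in> span ?V"
      using set ps qs by (intro span_base) (auto simp: sorted_lists_over_def)
    moreover have "symmetrized_product ps qs - c *\<^sub>R prod_list (ps @ qs) \<in> span ?V"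
      using symmetrized_product_leading_term[of ps qs] set PQ Suc.IH len by (auto simp: c_def)
    ultimately have "c *\<^sub>R prod_list (ps @ qs) \<in> span ?V"
      using span_diff by fastforce
    then have "(1 / c) *\<^sub>R c *\<^sub>R prod_list (ps @ qs) \<in> span ?V" by (rule span_scale)
    then have "prod_list (ps @ qs) \<in> span ?V" by (simp add: c_def)
    moreover have "prod_list bs - prod_list (ps @ qs) \<in> span ?V"
      using prod_list_permute_primitives[OF m] bs PQ Suc.IH by auto
    ultimately show ?thesis using span_add by fastforce
  qed
  have expand: "prod_list xs \<in> span {prod_list bs | bs. set bs \<subseteq> P \<union> Q \<and> length bs = length xs}"
    if "set xs \<subseteq> primitives \<Delta>" for xs
    using that
  proof (induction xs)
    case Nil
    then show ?case by (intro span_base) auto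
  next
    case (Cons x xs)
    have "x * prod_list xs \<in> span {prod_list bs | bs. set bs \<subseteq> P \<union> Q \<and> length bs = length (x # xs)}"
    proof (rule bilinear_span[OF bilinear_times])
      show "x \<in> span (P \<union> Q)" using Cons.prems B by auto
      show "prod_list xs \<in> span {prod_list bs | bs. set bs \<subseteq> P \<union> Q \<and> length bs = length xs}"
        using Cons by simp
      fix b y assume "b \<in> P \<union> Q" "y \<in> {prod_list bs | bs. set bs \<subseteq> P \<union> Q \<and> length bs = length xs}"
      then obtain bs where "y = prod_list bs" "set (b # bs) \<subseteq> P \<union> Q" "length (b # bs) = length (x # xs)" by auto
      then show "b * y \<in> span {prod_list bs | bs. set bs \<subseteq> P \<union> Q \<and> length bs = length (x # xs)}"
        by (intro span_base) (metis (mono_tags, lifting) mem_Collect_eq prod_list.Cons)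
    qed
    then show ?case by simp
  qed
  have "prod_list xs \<in> span ?V" if "set xs \<subseteq> primitives \<Delta>" "length xs < Suc n" for xs
  proof (cases "length xs = n")
    case True
    have "span {prod_list bs | bs. set bs \<subseteq> P \<union> Q \<and> length bs = length xs} \<subseteq> span ?V"
      using basis True by (intro span_minimal) auto
    then show ?thesis using expand[OF that(1)] by auto
  next
    case False
    then have "prod_list xs \<in> filt n" using that by (intro prod_list_in_filt) auto
    then show ?thesis using Suc.IH by auto
  qed
  then show ?case unfolding filt_def by (intro span_minimal) auto
qed

end

section \<open>Generation by primitive elements\<close>

context graded_connected_hopf_algebra
begin

text \<open>Coassociativity brings the two inner tensor factors into a common coproduct, to which
  cocommutativity applies; \<open>nested\<close> is this rebracketing.\<close>

lemma sweedler_swap_middle: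
  fixes F :: "'a \<Rightarrow> 'a \<Rightarrow> 'a \<Rightarrow> 'a \<Rightarrow> 'b::real_vector"
  assumes "cocommutative \<Delta>"
    and F: "\<And>b c d. linear (\<lambda>a. F a b c d)" "\<And>a c d. linear (\<lambda>b. F a b c d)"
      "\<And>a b d. linear (\<lambda>c. F a b c d)" "\<And>a b c. linear (\<lambda>d. F a b c d)"
  shows "sweedler (\<lambda>u v. sweedler (\<lambda>a b. sweedler (\<lambda>c d. F a b c d) v) u) x =
         sweedler (\<lambda>u v. sweedler (\<lambda>a b. sweedler (\<lambda>c d. F a c b d) v) u) x"
proof -
  have nested: "sweedler (\<lambda>u v. sweedler (\<lambda>a b. sweedler (\<lambda>c d. G a b c d) v) u) x =
      sweedler (\<lambda>a v. sweedler (\<lambda>w d. sweedler (\<lambda>b c. G a b c d) w) v) x"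
    if G: "\<And>b c d. linear (\<lambda>a. G a b c d)" "\<And>a c d. linear (\<lambda>b. G a b c d)"
      "\<And>a b d. linear (\<lambda>c. G a b c d)" "\<And>a b c. linear (\<lambda>d. G a b c d)"
    for G :: "'a \<Rightarrow> 'a \<Rightarrow> 'a \<Rightarrow> 'a \<Rightarrow> 'b"
  proof -
    have "sweedler (\<lambda>u v. sweedler (\<lambda>a b. sweedler (\<lambda>c d. G a b c d) v) u) x =
        sweedler (\<lambda>a v. sweedler (\<lambda>b w. sweedler (\<lambda>c d. G a b c d) w) v) x"
      by (rule sweedler_coassoc)
        (rule bilinearI; (rule linear_sweedler_param | rule linear_sweedler); (rule bilinearI)?; rule G)+
    moreover have "sweedler (\<lambda>b w. sweedler (\<lambda>c d. G a b c d) w) v = sweedler (\<lambda>w d. sweedler (\<lambda>b c. G a b c d) w) v" for a v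
      by (rule sweedler_coassoc[symmetric]) (rule bilinearI; rule G)+
    ultimately show ?thesis by simp
  qed
  have "sweedler (\<lambda>b c. F a b c d) w = sweedler (\<lambda>b c. F a c b d) w" for a d w
    by (rule sweedler_cocommutative[OF assms(1), symmetric]) (rule bilinearI; rule F)
  then show ?thesis
    by (simp only: nested[OF F] nested[OF F(1,3,2,4)])
qed

text \<open>The second Adams operation. Its eigenvalue \<open>2 ^ k\<close> on \<open>p ^ k\<close>
  recovers the exponent.\<close>

definition adams :: "'a \<Rightarrow> 'a" where
  "adams = conv id id"

lemma linear_adams: "linear adams"
  unfolding adams_def by (intro linear_conv linear_id)

lemma adams_eq: "adams x = sweedler (\<lambda>u v. u * v) x"
  by (simp add: adams_def conv_def)

lemma adams_power: "p \<in> primitives \<Delta> \<Longrightarrow> adams (p ^ k) = 2 ^ k *\<^sub>R p ^ k"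
  unfolding adams_def using conv_power[of p id id 1 1 k] by (simp add: linear_id)

lemma adams_one: "adams 1 = 1"
  by (simp add: adams_eq sweedler_one bilinear_times)

text \<open>\<open>\<Delta> (u * v)\<close> pairs the factors 1, 3 and 2, 4 of the fourfold
  coproduct of \<open>x\<close>; exchanging the inner ones gives 1, 2 and 3, 4, that is,
  \<open>adams\<close> on each side.\<close>

lemma coproduct_adams:
  assumes "cocommutative \<Delta>"
  shows "\<Delta> (adams x) = tensor_map [adams, adams] (\<Delta> x)"
proof -
  have "\<Delta> (adams x) = sweedler (\<lambda>u v. \<Delta> (u * v)) x"
    unfolding adams_eq by (rule sweedler_comp[OF linear_coproduct bilinear_times])
  also have "\<dots> = sweedler (\<lambda>u v. sweedler (\<lambda>a b. sweedler (\<lambda>c d. pure_tensor [a * c, b * d]) v) u) x"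
    by (simp only: coproduct_mult tensor_times_eq)
  also have "\<dots> = sweedler (\<lambda>u v. sweedler (\<lambda>a b. sweedler (\<lambda>c d. pure_tensor [a * b, c * d]) v) u) x"
    by (rule sweedler_swap_middle[OF assms])
      (intro linear_comp[OF linear_pure_tensor_2(1)] linear_comp[OF linear_pure_tensor_2(2)]
        linear_mult_left linear_mult_right linear_ident)+
  also have "\<dots> = sweedler (\<lambda>u v. pure_tensor [adams u, adams v]) x"
  proof -
    have "sweedler (\<lambda>c d. pure_tensor [y, c * d]) v = pure_tensor [y, adams v]" for y v
      unfolding adams_eq by (rule sweedler_comp[OF linear_pure_tensor_2(2) bilinear_times, symmetric])
    moreover have "sweedler (\<lambda>a b. pure_tensor [a * b, y]) u = pure_tensor [adams u, y]" for y u
      unfolding adams_eq by (rule sweedler_comp[OF linear_pure_tensor_2(1) bilinear_times, symmetric])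
    ultimately show ?thesis by simp
  qed
  also have "\<dots> = sweedler (\<lambda>u v. tensor_map [adams, adams] (pure_tensor [u, v])) x"
    by (simp add: tensor_map_pure linear_adams)
  also have "\<dots> = tensor_map [adams, adams] (\<Delta> x)"
    unfolding coproduct_eq_sweedler[of x]
    by (rule sweedler_comp[OF _ bilinear_pure_tensor, symmetric]) (simp add: linear_tensor_map linear_adams)
  finally show ?thesis .
qed

text \<open>By connectedness the terms of bidegree \<open>(0, n)\<close> and \<open>(n, 0)\<close>
  have the form \<open>1 \<otimes> v\<close> and \<open>u \<otimes> 1\<close>; the counit laws
  identify \<open>v\<close> and \<open>u\<close> with \<open>x\<close>.\<close>

lemma coproduct_reduced:
  assumes "x \<in> gr n" "n > 0"
  shows "\<Delta> x - pure_tensor [x, 1] - pure_tensor [1, x] \<in>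
    span {pure_tensor [u, v] | u v i j. 0 < i \<and> 0 < j \<and> i + j = n \<and> u \<in> gr i \<and> v \<in> gr j}"
    (is "_ \<in> span ?Z")
proof -
  have "\<exists>u\<in>gr n. \<exists>v\<in>gr n. t - pure_tensor [u, 1] - pure_tensor [1, v] \<in> span ?Z"
    if "t \<in> span {pure_tensor [u, v] | u v i j. i + j = n \<and> u \<in> gr i \<and> v \<in> gr j}" for t
    using that
  proof (induction rule: span_induct_alt)
    case base
    show ?case
      by (rule bexI[of _ 0], rule bexI[of _ 0])
        (simp_all add: linear_0[OF linear_pure_tensor_2(1)] linear_0[OF linear_pure_tensor_2(2)]
          span_zero subspace_0[OF subspace_gr])
  next
    case (step c z t)
    then obtain u v where uv: "u \<in> gr n" "v \<in> gr n" "t - pure_tensor [u, 1] - pure_tensor [1, v] \<in> span ?Z" by blast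
    obtain a b i j where ab: "z = pure_tensor [a, b]" "i + j = n" "a \<in> gr i" "b \<in> gr j" using step by blast
    consider "i = 0" "j = n" | "j = 0" "i = n" | "0 < i" "0 < j" using ab(2) by force
    then show ?case
    proof cases
      case 1
      then obtain k where a: "a = k *\<^sub>R 1" using ab(3) connected by (auto simp: span_singleton)
      have mem: "v + (c * k) *\<^sub>R b \<in> gr n"
        using uv ab(4) 1 by (intro subspace_add subspace_scale subspace_gr) auto
      have eq: "c *\<^sub>R z + t - pure_tensor [u, 1] - pure_tensor [1, v + (c * k) *\<^sub>R b] =
          t - pure_tensor [u, 1] - pure_tensor [1, v]"
        by (simp add: ab(1) a linear_add[OF linear_pure_tensor_2(2)] linear_scale[OF linear_pure_tensor_2(2)]
            linear_scale[OF linear_pure_tensor_2(1)])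
      show ?thesis
        by (rule bexI[OF bexI[OF _ mem] uv(1)]) (simp only: eq uv(3))
    next
      case 2
      then obtain k where b: "b = k *\<^sub>R 1" using ab(4) connected by (auto simp: span_singleton)
      have mem: "u + (c * k) *\<^sub>R a \<in> gr n"
        using uv ab(3) 2 by (intro subspace_add subspace_scale subspace_gr) auto
      have eq: "c *\<^sub>R z + t - pure_tensor [u + (c * k) *\<^sub>R a, 1] - pure_tensor [1, v] =
          t - pure_tensor [u, 1] - pure_tensor [1, v]"
        by (simp add: ab(1) b linear_add[OF linear_pure_tensor_2(1)] linear_scale[OF linear_pure_tensor_2(2)]
            linear_scale[OF linear_pure_tensor_2(1)])
      show ?thesis
        by (rule bexI[OF bexI[OF _ uv(2)] mem]) (simp only: eq uv(3))
    next
      case 3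
      then have "z \<in> ?Z" using ab by blast
      then have "c *\<^sub>R z + (t - pure_tensor [u, 1] - pure_tensor [1, v]) \<in> span ?Z"
        by (intro span_add span_scale span_base uv)
      then have "c *\<^sub>R z + t - pure_tensor [u, 1] - pure_tensor [1, v] \<in> span ?Z"
        by (simp add: add_diff_eq)
      then show ?thesis using uv by blast
    qed
  qed
  then obtain u v where uv: "u \<in> gr n" "v \<in> gr n"
    and z: "\<Delta> x - pure_tensor [u, 1] - pure_tensor [1, v] \<in> span ?Z"
    using gr_coproduct[OF assms(1)] by blast
  have Bl: "bilinear (\<lambda>u v. \<epsilon> u *\<^sub>R (v :: 'a))" and Br: "bilinear (\<lambda>u v. \<epsilon> v *\<^sub>R (u :: 'a))"
    by (intro bilinearI linear_compose_scale_right linear_ident linear_scaleR_left linear_counit)+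
  \<comment> \<open>The counit vanishes in positive degree, so it kills the remaining sum as well as
    the term with \<open>u\<close> on the left.\<close>
  have "tensor_lift2 (\<lambda>u v. \<epsilon> u *\<^sub>R v) (\<Delta> x - pure_tensor [u, 1] - pure_tensor [1, v]) = 0"
    by (rule linear_eq_0_on_span[OF linear_tensor_lift2[OF Bl] _ z]) (auto simp: tensor_lift2_pure Bl gr_counit)
  then have "x = v"
    using uv assms(2)
    by (simp add: linear_diff[OF linear_tensor_lift2[OF Bl]] tensor_lift2_pure Bl counit_left counit_one gr_counit)
  moreover have "tensor_lift2 (\<lambda>u v. \<epsilon> v *\<^sub>R u) (\<Delta> x - pure_tensor [u, 1] - pure_tensor [1, v]) = 0"
    by (rule linear_eq_0_on_span[OF linear_tensor_lift2[OF Br] _ z]) (auto simp: tensor_lift2_pure Br gr_counit)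
  then have "x = u"
    using uv assms(2)
    by (simp add: linear_diff[OF linear_tensor_lift2[OF Br]] tensor_lift2_pure Br counit_right counit_one gr_counit)
  ultimately show ?thesis using z by simp
qed

text \<open>Only the total exponent \<open>k\<close> is kept, since it alone determines the
  eigenvalue of \<open>tensor_map [adams, adams]\<close>.\<close>

lemma coproduct_power:
  assumes "p \<in> primitives \<Delta>"
  shows "\<Delta> (p ^ k) \<in> span {pure_tensor [p ^ i, p ^ j] | i j. i + j = k}"
proof (induction k)
  case 0
  then show ?case by (auto simp: coproduct_one intro!: span_base)
next
  case (Suc k)
  let ?B = "\<lambda>u v. pure_tensor [u, v * p] + pure_tensor [u * p, v]"
  have b: "bilinear (\<lambda>u v. pure_tensor [u, v * p])" "bilinear (\<lambda>u v. pure_tensor [u * p, v])"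
    by (rule bilinear_comp[OF bilinear_pure_tensor linear_ident linear_mult_right[OF linear_ident]],
        rule bilinear_comp[OF bilinear_pure_tensor linear_mult_right[OF linear_ident] linear_ident])
  have B: "bilinear ?B" by (rule bilinear_add[OF b])
  have "\<Delta> (p ^ Suc k) = tensor_lift2 ?B (\<Delta> (p ^ k))"
    unfolding power_Suc2 coproduct_eq_sweedler[of "p ^ k * p"]
    by (simp add: sweedler_mult_primitive[OF bilinear_pure_tensor assms] sweedler_add[OF b, symmetric]
        flip: sweedler_def)
  also have "\<dots> \<in> span {pure_tensor [p ^ i, p ^ j] | i j. i + j = Suc k}"
  proof (rule linear_image_span[OF linear_tensor_lift2[OF B] _ Suc])
    fix t assume "t \<in> {pure_tensor [p ^ i, p ^ j] | i j. i + j = k}"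
    then obtain i j where ij: "t = pure_tensor [p ^ i, p ^ j]" "i + j = k" by blast
    have "pure_tensor [p ^ i, p ^ Suc j] \<in> {pure_tensor [p ^ i, p ^ j] | i j. i + j = Suc k}"
      "pure_tensor [p ^ Suc i, p ^ j] \<in> {pure_tensor [p ^ i, p ^ j] | i j. i + j = Suc k}"
      using ij(2) by (blast intro: add_Suc_right add_Suc trans)+
    then show "tensor_lift2 ?B t \<in> span {pure_tensor [p ^ i, p ^ j] | i j. i + j = Suc k}"
      unfolding ij(1) tensor_lift2_pure[OF B] power_Suc2 by (intro span_add span_base)
  qed
  finally show ?case .
qed

abbreviation primitive_powers :: "'a set" where
  "primitive_powers \<equiv> {p ^ k | p k. p \<in> primitives \<Delta>}"

text \<open>Polarization writes the symmetrized product by powers, and its leading term is a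
  factorial times the given product; dividing leaves terms with fewer factors.\<close>

lemma filt_subset_span_primitive_powers: "filt n \<subseteq> span primitive_powers"
proof (induction n)
  case 0
  then show ?case by (simp add: filt_0 span_zero)
next
  case (Suc n)
  have "prod_list xs \<in> span primitive_powers" if xs: "set xs \<subseteq> primitives \<Delta>" "length xs < Suc n" for xs
  proof (cases "length xs = n")
    case True
    let ?s = "\<Sum>\<sigma> | \<sigma> permutes {..<length xs}. prod_list (permute_list \<sigma> xs)"
    have "?s \<in> span {p ^ length xs | p. p \<in> primitives \<Delta>}"
      by (rule sum_permutations_in_span_powers[OF subspace_primitives xs(1)])
    also have "\<dots> \<subseteq> span primitive_powers" by (intro span_mono) blast
    finally have 1: "?s \<in> span primitive_powers" .
    have "?s - fact (length xs) *\<^sub>R prod_list xs \<in> span primitive_powers"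
      using sum_permutations_leading_term[OF xs(1)] Suc unfolding True by (rule subsetD[rotated])
    from span_diff[OF 1 this] have "fact (length xs) *\<^sub>R prod_list xs \<in> span primitive_powers" by simp
    then have "(1 / fact (length xs)) *\<^sub>R fact (length xs) *\<^sub>R prod_list xs \<in> span primitive_powers"
      by (rule span_scale)
    then show ?thesis by simp
  next
    case False
    then show ?thesis using xs Suc prod_list_in_filt[of xs n] by auto
  qed
  then show ?case unfolding filt_def by (intro span_minimal) auto
qed

lemma span_primitive_powers_mult:
  assumes "x \<in> span primitive_powers" "y \<in> span primitive_powers"
  shows "x * y \<in> span primitive_powers"
proof (rule bilinear_span[OF bilinear_times _ assms])
  fix x y assume "x \<in> primitive_powers" "y \<in> primitive_powers"
  then obtain p k q l where *: "p \<in> primitives \<Delta>" "q \<in> primitives \<Delta>" "x = p ^ k" "y = q ^ l" by blast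
  have "prod_list (replicate k p @ replicate l q) \<in> filt (Suc (k + l))"
    using * by (intro prod_list_in_filt) auto
  then show "x * y \<in> span primitive_powers"
    using filt_subset_span_primitive_powers * by (auto simp: prod_list_replicate)
qed

text \<open>Modulo products of elements of smaller degree, \<open>adams\<close> acts on a homogeneous \<open>x\<close> as
  multiplication by \<open>2\<close>. After a correction of \<open>x\<close> by powers of primitive elements it does so
  modulo primitive elements. The reduced coproduct of the result is then an eigenvector of
  \<open>adams \<otimes> adams\<close> with eigenvalue \<open>2\<close>, but lies in a span of eigenvectors with other
  eigenvalues.\<close>

lemma cocommutative_generated_by_primitives:
  assumes coc: "cocommutative \<Delta>"
  shows "x \<in> gr n \<Longrightarrow> x \<in> span primitive_powers"
proof (induction n arbitrary: x rule: less_induct)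
  case (less n)
  show ?case
  proof (cases "n = 0")
    case True
    have "1 \<in> primitive_powers" using subspace_0[OF subspace_primitives] power_0 by (metis (mono_tags, lifting) mem_Collect_eq)
    then have "span {1} \<subseteq> span primitive_powers" by (intro span_mono) auto
    then show ?thesis using less.prems True connected by auto
  next
    case False
    then have n: "n > 0" by simp
    let ?U = "span primitive_powers"
    let ?Z = "{pure_tensor [u, v] | u v i j. 0 < i \<and> 0 < j \<and> i + j = n \<and> u \<in> gr i \<and> v \<in> gr j}"
    \<comment> \<open>The condition \<open>i + j \<noteq> 1\<close> excludes exactly the eigenvalue
      2.\<close>
    let ?Y = "{pure_tensor [p ^ i, q ^ j] | p q i j. p \<in> primitives \<Delta> \<and> q \<in> primitives \<Delta> \<and> i + j \<noteq> 1}"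
    let ?T = "tensor_map [adams, adams]"
    define D where "D y = \<Delta> y - pure_tensor [y, 1] - pure_tensor [1, y]" for y
    have linD: "linear D"
      unfolding D_def by (intro linear_compose_sub linear_coproduct linear_pure_tensor_2)
    have linT: "linear ?T" by (simp add: linear_tensor_map linear_adams)
    have D0: "D y = 0 \<longleftrightarrow> y \<in> primitives \<Delta>" for y
      by (auto simp: D_def primitives_def algebra_simps)
    have TD: "?T (D y) = D (adams y)" for y
      by (simp add: D_def linear_diff[OF linT] tensor_map_pure linear_adams adams_one coproduct_adams[OF coc])

    have grU: "y \<in> ?U" if "y \<in> gr i" "i < n" for y i
      using less.IH that by blast
    \<comment> \<open>Multiplying the factors of \<open>\<Delta> x\<close> gives
      \<open>adams x\<close>, and each of the two subtracted terms gives \<open>x\<close>.\<close>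
    have "adams x - 2 *\<^sub>R x = tensor_lift2 (\<lambda>u v. u * v) (D x)"
      by (simp add: D_def linear_diff[OF linear_tensor_lift2] bilinear_times tensor_lift2_pure adams_eq
          sweedler_def scaleR_2)
    also have "\<dots> \<in> ?U"
    proof (rule linear_image_span[OF linear_tensor_lift2[OF bilinear_times]])
      show "D x \<in> span ?Z" unfolding D_def by (rule coproduct_reduced[OF less.prems n])
      fix z assume "z \<in> ?Z"
      then obtain u v i j where uv: "z = pure_tensor [u, v]" "0 < i" "0 < j" "i + j = n" "u \<in> gr i" "v \<in> gr j" by blast
      then have "u \<in> ?U" "v \<in> ?U" using grU[of u i] grU[of v j] by auto
      then show "tensor_lift2 (\<lambda>u v. u * v) z \<in> ?U"
        unfolding uv(1) tensor_lift2_pure[OF bilinear_times] by (rule span_primitive_powers_mult)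
    qed
    finally have y: "adams x - 2 *\<^sub>R x \<in> ?U" .
    \<comment> \<open>On \<open>p ^ k\<close> the operator \<open>adams\<close> minus 2 is the
      scalar \<open>2 ^ k - 2\<close>, invertible for \<open>k \<noteq> 1\<close>; for
      \<open>k = 1\<close> the element is primitive itself and needs no correction.\<close>
    have "\<exists>w\<in>?U. y - (adams w - 2 *\<^sub>R w) \<in> primitives \<Delta>" if "y \<in> ?U" for y
      using that
    proof (induction rule: span_induct_alt)
      case base
      show ?case
        by (rule bexI[of _ 0]) (simp_all add: linear_0[OF linear_adams] span_zero subspace_0[OF subspace_primitives])
    next
      case (step c z y)
      then obtain w where w: "w \<in> ?U" "y - (adams w - 2 *\<^sub>R w) \<in> primitives \<Delta>" by blast
      obtain p k where p: "z = p ^ k" "p \<in> primitives \<Delta>" using step by blast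
      show ?case
      proof (cases "k = 1")
        case True
        have "c *\<^sub>R p + (y - (adams w - 2 *\<^sub>R w)) \<in> primitives \<Delta>"
          using w p by (intro subspace_add subspace_scale subspace_primitives)
        then show ?thesis using w p True by (intro bexI[of _ w]) (simp_all add: algebra_simps)
      next
        case False
        then have k: "2 ^ k - 2 \<noteq> (0::real)"
          using power_inject_exp[of "2::real" k 1] by auto
        define b where "b = c / (2 ^ k - 2)"
        let ?w = "w + b *\<^sub>R p ^ k"
        have "adams ?w - 2 *\<^sub>R ?w = adams w - 2 *\<^sub>R w + (b * (2 ^ k - 2)) *\<^sub>R p ^ k"
          by (simp add: linear_add[OF linear_adams] linear_scale[OF linear_adams] adams_power[OF p(2)]
              algebra_simps)
        also have "\<dots> = adams w - 2 *\<^sub>R w + c *\<^sub>R z" using k p by (simp add: b_def)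
        finally have eq: "c *\<^sub>R z + y - (adams ?w - 2 *\<^sub>R ?w) = y - (adams w - 2 *\<^sub>R w)" by simp
        have "p ^ k \<in> ?U" using p by (intro span_base) blast
        then have "?w \<in> ?U" by (intro span_add span_scale w(1))
        then show ?thesis
          by (rule bexI[rotated]) (simp only: eq w(2))
      qed
    qed
    with y obtain w where w: "w \<in> ?U" "adams x - 2 *\<^sub>R x - (adams w - 2 *\<^sub>R w) \<in> primitives \<Delta>" by blast
    define x' where "x' = x - w"
    have r: "D (adams x' - 2 *\<^sub>R x') = 0"
      using w(2) unfolding D0 by (simp add: x'_def linear_diff[OF linear_adams] algebra_simps)

    \<comment> \<open>In positive degree the counit vanishes, so constant terms can be removed; both
      exponents in the tensors for \<open>D x\<close> are then positive and add up to at least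
      2.\<close>
    have pos: "y \<in> span {p ^ k | p k. p \<in> primitives \<Delta> \<and> 0 < k}" if "y \<in> gr i" "0 < i" "i < n" for y i
    proof -
      have lin: "linear (\<lambda>y. y - \<epsilon> y *\<^sub>R 1)"
        by (intro linear_compose_sub linear_ident linear_scaleR_left linear_counit)
      have "y - \<epsilon> y *\<^sub>R 1 \<in> span {p ^ k | p k. p \<in> primitives \<Delta> \<and> 0 < k}"
      proof (rule linear_image_span[OF lin _ grU[OF that(1,3)]])
        fix z assume "z \<in> primitive_powers"
        then obtain p k where p: "z = p ^ k" "p \<in> primitives \<Delta>" by blast
        show "z - \<epsilon> z *\<^sub>R 1 \<in> span {p ^ k | p k. p \<in> primitives \<Delta> \<and> 0 < k}"
        proof (cases k)
          case 0
          then show ?thesis by (simp add: p counit_one span_zero)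
        next
          case (Suc l)
          then have "\<epsilon> z = 0" using p by (simp add: counit_mult counit_primitive)
          moreover have "z \<in> {p ^ k | p k. p \<in> primitives \<Delta> \<and> 0 < k}" using p Suc by blast
          ultimately show ?thesis by (simp add: span_base)
        qed
      qed
      then show ?thesis using gr_counit[OF that(1,2)] by simp
    qed
    have Dx: "D x \<in> span ?Y"
    proof -
      have "z \<in> span ?Y" if z: "z \<in> ?Z" for z
      proof -
        obtain u v i j where uv: "z = pure_tensor [u, v]" "0 < i" "0 < j" "i + j = n" "u \<in> gr i" "v \<in> gr j"
          using z by blast
        show ?thesis unfolding uv(1)
        proof (rule bilinear_span[OF bilinear_pure_tensor _ pos[OF uv(5,2)] pos[OF uv(6,3)]])
          fix a b assume "a \<in> {p ^ k | p k. p \<in> primitives \<Delta> \<and> 0 < k}" "b \<in> {p ^ k | p k. p \<in> primitives \<Delta> \<and> 0 < k}"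
          then obtain p k q l where *: "a = p ^ k" "b = q ^ l" "p \<in> primitives \<Delta>" "q \<in> primitives \<Delta>" "0 < k" "0 < l" by blast
          then have "k + l \<noteq> 1" by simp
          then show "pure_tensor [a, b] \<in> span ?Y" using * by (intro span_base) blast
        qed (use uv in auto)
      qed
      then have "span ?Z \<subseteq> span ?Y" by (intro span_minimal subsetI subspace_span)
      then show ?thesis
        using coproduct_reduced[OF less.prems n] unfolding D_def by blast
    qed
    \<comment> \<open>\<open>D\<close> kills the powers with \<open>k = 1\<close>; for other
      \<open>k\<close> all tensors have total exponent \<open>k\<close>.\<close>
    have Dw: "D w \<in> span ?Y"
    proof (rule linear_image_span[OF linD _ w(1)])
      fix z assume "z \<in> primitive_powers"
      then obtain p k where p: "z = p ^ k" "p \<in> primitives \<Delta>" by blast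
      show "D z \<in> span ?Y"
      proof (cases "k = 1")
        case True
        then have "D z = 0" using p by (simp add: D0)
        then show ?thesis by (simp add: span_zero)
      next
        case False
        let ?W = "{pure_tensor [p ^ i, p ^ j] | i j. i + j = k}"
        have "pure_tensor [p ^ i, p ^ j] \<in> ?W" if "i + j = k" for i j using that by blast
        from this[of k 0] this[of 0 k] have "pure_tensor [p ^ k, 1] \<in> ?W" "pure_tensor [1, p ^ k] \<in> ?W" by simp_all
        then have "D z \<in> span ?W"
          unfolding D_def p(1) by (intro span_diff coproduct_power p(2) span_base)
        also have "?W \<subseteq> ?Y" using p(2) False by blast
        then have "span ?W \<subseteq> span ?Y" by (rule span_mono)
        finally show ?thesis .
      qed
    qed
    have eig: "\<forall>e\<in>?Y. \<exists>l. ?T e = l *\<^sub>R e \<and> l \<noteq> 2"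
    proof
      fix e assume "e \<in> ?Y"
      then obtain p q i j where e: "e = pure_tensor [p ^ i, q ^ j]" "p \<in> primitives \<Delta>" "q \<in> primitives \<Delta>" "i + j \<noteq> 1" by blast
      have "?T e = 2 ^ (i + j) *\<^sub>R e"
        by (simp add: e(1) tensor_map_pure linear_adams adams_power e(2,3) linear_scale[OF linear_pure_tensor_2(1)]
            linear_scale[OF linear_pure_tensor_2(2)] power_add)
      moreover have "2 ^ (i + j) \<noteq> (2::real)"
        using power_inject_exp[of "2::real" "i + j" 1] e(4) by auto
      ultimately show "\<exists>l. ?T e = l *\<^sub>R e \<and> l \<noteq> 2" by blast
    qed
    from bchoice[OF this] obtain l where l: "\<forall>e\<in>?Y. ?T e = l e *\<^sub>R e \<and> l e \<noteq> 2" by blast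
    have "D x' = 0"
    proof (rule eigenvector_in_span_other_eigenvectors_zero[OF linT, where l = l])
      show "D x' \<in> span ?Y" using Dx Dw by (simp add: x'_def linear_diff[OF linD] span_diff)
      show "?T (D x') = 2 *\<^sub>R D x'"
        using r by (simp add: TD linear_diff[OF linD] linear_scale[OF linD])
    qed (use l in auto)
    then have "x' \<in> primitives \<Delta>" by (simp add: D0)
    then have "x' ^ 1 \<in> primitive_powers" by blast
    then have "x' \<in> ?U" by (simp add: span_base)
    then have "x' + w \<in> ?U" using w(1) by (rule span_add)
    then show ?thesis by (simp add: x'_def)
  qed
qed

section \<open>Spanning in the cocommutative case\<close>

lemma cocommutative_span_primitive_powers:
  assumes "cocommutative \<Delta>"
  shows "span primitive_powers = UNIV"
proof -
  have "x \<in> span primitive_powers" for x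
  proof -
    obtain f where f: "\<forall>n. f n \<in> gr n" "x = (\<Sum>n | f n \<noteq> 0. f n)"
      using direct_sum[of x] by blast
    then show ?thesis
      using cocommutative_generated_by_primitives[OF assms] by (metis (no_types, lifting) span_sum)
  qed
  then show ?thesis by blast
qed

lemma span_symmetrized_products:
  assumes "cocommutative \<Delta>" "primitives \<Delta> = span (P \<union> Q)" "linear_order_on P r" "linear_order_on Q s"
  shows "span ((\<lambda>(ps, qs). symmetrized_product ps qs) ` (sorted_lists_over P r \<times> sorted_lists_over Q s)) = UNIV"
    (is "span ?V = UNIV")
proof -
  have "p ^ k \<in> span ?V" if "p \<in> primitives \<Delta>" for p k
  proof -
    have "prod_list (replicate k p) \<in> filt (Suc k)"
      using that by (intro prod_list_in_filt) auto
    then show ?thesis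
      using filt_subset_span_symmetrized_products[OF assms(2-4), of "Suc k"] by (auto simp: prod_list_replicate)
  qed
  then have "span primitive_powers \<subseteq> span ?V" by (intro span_minimal) auto
  then show ?thesis using cocommutative_span_primitive_powers[OF assms(1)] by auto
qed

text \<open>The sign \<open>s\<close> is 1 for \<open>tau_plus\<close> and -1 for
  \<open>tau_minus\<close>. For odd \<open>a\<close> both end signs in
  \<open>alternating_anticommutator\<close> equal \<open>s\<close>, so each barred element
  contributes the factor \<open>s\<close>.\<close>

lemma alternating_symmetrized_product:
  assumes lin: "linear f" "linear g" and one: "f 1 = 1" "g 1 = 1"
    and f: "\<And>x y. f (x * y) = f x * f y" and g: "\<And>x y. g (x * y) = g x * g y"
    and ps: "\<And>p. p \<in> set ps \<Longrightarrow> p \<in> primitives \<Delta> \<and> f p = p \<and> g p = p"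
    and qs: "\<And>q. q \<in> set qs \<Longrightarrow> q \<in> primitives \<Delta> \<and> f q = s *\<^sub>R q \<and> g q = - s *\<^sub>R q"
    and "odd a"
  shows "alternating f g a (symmetrized_product ps qs) =
    (s ^ length qs * real a ^ length ps) *\<^sub>R symmetrized_product ps qs"
proof -
  obtain n where a: "a = Suc n" and "even n" using \<open>odd a\<close> by (cases a) auto
  let ?T = "alternating f g a"
  have linT: "linear ?T" unfolding a by (rule linear_alternating[OF lin])
  show ?thesis using qs
  proof (induction qs rule: rev_induct)
    case Nil
    \<comment> \<open>Polarization takes sums of the \<open>ps\<close>, so the powers have to come
      from a subspace fixed pointwise by both maps.\<close>
    let ?V = "{p \<in> primitives \<Delta>. f p = p \<and> g p = p}"
    have V: "subspace ?V"
      using subspace_primitives lin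
      by (auto simp: subspace_def linear_0 linear_add linear_scale)
    have "?T (symmetrized_product ps []) = real a ^ length ps *\<^sub>R symmetrized_product ps []"
    proof (rule linear_eq_on_span[OF linT linear_compose_scale_right[OF linear_ident]])
      show "symmetrized_product ps [] \<in> span {p ^ length ps | p. p \<in> ?V}"
        unfolding symmetrized_product_Nil
        by (rule sum_permutations_in_span_powers[OF V]) (use ps in auto)
      fix y assume "y \<in> {p ^ length ps | p. p \<in> ?V}"
      then obtain p where p: "y = p ^ length ps" "p \<in> primitives \<Delta>" "f p = p" "g p = p" by blast
      have "f (p ^ k) = p ^ k" "g (p ^ k) = p ^ k" for k
        by (induction k) (simp_all add: one f g p)
      then show "?T y = real a ^ length ps *\<^sub>R y"
        unfolding p(1) a by (intro alternating_power p lin)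
    qed
    then show ?case by simp
  next
    case (snoc q qs)
    have q: "q \<in> primitives \<Delta>" "f q = s *\<^sub>R q" "g q = - s *\<^sub>R q" using snoc.prems[of q] by auto
    have IH: "?T (symmetrized_product ps qs) = (s ^ length qs * real a ^ length ps) *\<^sub>R symmetrized_product ps qs"
      using snoc by auto
    have "?T (symmetrized_product ps (qs @ [q])) =
        s *\<^sub>R (q * ?T (symmetrized_product ps qs)) + s *\<^sub>R (?T (symmetrized_product ps qs) * q)"
      using alternating_anticommutator[OF lin f g q, of n] \<open>even n\<close>
      by (simp add: symmetrized_product_snoc a)
    then show ?case by (simp add: IH symmetrized_product_snoc algebra_simps)
  qed
qed

text \<open>Two equal vectors would give a relation with coefficients 1 and -1, so independence of
  the family also yields injectivity.\<close>

lemma symmetrized_products_inj_independent: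
  assumes B: "independent B" "B \<subseteq> primitives \<Delta>"
    and I: "\<And>ps qs. (ps, qs) \<in> I \<Longrightarrow> set ps \<union> set qs \<subseteq> B"
    and inj: "inj_on (\<lambda>(ps, qs). mset (ps @ qs)) I"
  defines "v \<equiv> \<lambda>(ps, qs). symmetrized_product ps qs"
  shows "inj_on v I" "independent (v ` I)"
proof -
  have family: "c j = 0" if "finite J" "J \<subseteq> I" "(\<Sum>j\<in>J. c j *\<^sub>R v j) = 0" "j \<in> J" for J c j
    by (rule symmetrized_products_independent[OF B that(1) _ inj_on_subset[OF inj that(2)] that(3)[unfolded v_def] that(4)])
      (use I that(2) in blast)
  show "inj_on v I"
  proof (rule inj_onI, rule ccontr)
    fix j k assume jk: "j \<in> I" "k \<in> I" "v j = v k" "j \<noteq> k"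
    have "(\<Sum>i\<in>{j, k}. (if i = j then 1 else - 1) *\<^sub>R v i) = 0"
      using jk by auto
    then have "(if j = j then 1 else - 1 :: real) = 0"
      using jk by (intro family[of "{j, k}"]) auto
    then show False by simp
  qed
  show "independent (v ` I)"
    unfolding independent_explicit_module
  proof (intro allI impI)
    fix t u x assume t: "finite t" "t \<subseteq> v ` I" "(\<Sum>x\<in>t. u x *\<^sub>R x) = 0" "x \<in> t"
    obtain J where J: "J \<subseteq> I" "finite J" "t = v ` J"
      using finite_subset_image[OF t(1,2)] by blast
    have "(\<Sum>j\<in>J. u (v j) *\<^sub>R v j) = 0"
      using t(3) unfolding J(3) by (subst (asm) sum.reindex[OF inj_on_subset[OF \<open>inj_on v I\<close> J(1)]]) simp
    moreover obtain j where "x = v j" "j \<in> J" using t(4) J(3) by blast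
    ultimately show "u x = 0" using family[of J "\<lambda>j. u (v j)"] J by blast
  qed
qed

end

text \<open>Applying \<open>f\<close> to a relation \<open>x + y = 0\<close> between the two parts
  gives \<open>x - y = 0\<close>.\<close>

lemma independent_Un_eigenspaces:
  fixes f :: "'a::real_vector \<Rightarrow> 'a"
  assumes "linear f" "independent P" "independent Q"
    and P: "\<And>x. x \<in> P \<Longrightarrow> f x = x" and Q: "\<And>x. x \<in> Q \<Longrightarrow> f x = - x"
  shows "independent (P \<union> Q)"
  unfolding independent_explicit_module
proof (intro allI impI)
  fix t u z assume t: "finite t" "t \<subseteq> P \<union> Q" "(\<Sum>x\<in>t. u x *\<^sub>R x) = 0" "z \<in> t"
  define x where "x = (\<Sum>x\<in>t \<inter> P. u x *\<^sub>R x)"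
  define y where "y = (\<Sum>x\<in>t - P. u x *\<^sub>R x)"
  have xy: "x + y = 0"
    using t(3) by (simp add: x_def y_def sum.Int_Diff[OF t(1), of _ P])
  have "f x = x"
    unfolding x_def linear_sum[OF assms(1)] by (intro sum.cong) (auto simp: linear_scale[OF assms(1)] P)
  moreover have "f y = - y"
    unfolding y_def linear_sum[OF assms(1)] sum_negf[symmetric]
    by (intro sum.cong) (use t(2) in \<open>auto simp: linear_scale[OF assms(1)] Q\<close>)
  ultimately have "x - y = 0"
    using linear_add[OF assms(1), of x y] by (simp add: xy linear_0[OF assms(1)])
  then have "2 *\<^sub>R x = 0" using xy by (simp add: scaleR_2)
  then have "x = 0" "y = 0" using xy by auto
  show "u z = 0"
  proof (cases "z \<in> P")
    case True
    then show ?thesis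
      using independentD[OF assms(2), of "t \<inter> P" u z] t \<open>x = 0\<close> by (auto simp: x_def)
  next
    case False
    then show ?thesis
      using independentD[OF assms(3), of "t - P" u z] t \<open>y = 0\<close> by (auto simp: y_def)
  qed
qed

text \<open>Disjointness lets a filter recover the two parts from the joint multiset, and a sorted
  list is determined by its multiset.\<close>

lemma sorted_lists_over_mset_inj:
  assumes "linear_order_on P r" "linear_order_on Q s" "P \<inter> Q = {}"
  shows "inj_on (\<lambda>(ps, qs). mset (ps @ qs)) (sorted_lists_over P r \<times> sorted_lists_over Q s)"
proof (rule inj_onI, clarify)
  fix ps qs ps' qs'
  assume ps: "ps \<in> sorted_lists_over P r" "ps' \<in> sorted_lists_over P r"
    and qs: "qs \<in> sorted_lists_over Q s" "qs' \<in> sorted_lists_over Q s"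
    and eq: "mset (ps @ qs) = mset (ps' @ qs')"
  have filter: "filter (\<lambda>x. x \<in> P) (ps @ qs) = ps \<and> filter (\<lambda>x. x \<notin> P) (ps @ qs) = qs"
    if "ps \<in> sorted_lists_over P r" "qs \<in> sorted_lists_over Q s" for ps qs
  proof -
    have "\<forall>x\<in>set ps. x \<in> P" "\<forall>x\<in>set qs. x \<notin> P"
      using that assms(3) by (auto simp: sorted_lists_over_def)
    then show ?thesis by (simp add: filter_id_conv filter_empty_conv)
  qed
  have "mset ps = mset ps'" "mset qs = mset qs'"
    using filter[OF ps(1) qs(1)] filter[OF ps(2) qs(2)] eq mset_filter by metis+
  moreover have "antisym r" "antisym s"
    using assms by (auto simp: order_on_defs)
  ultimately show "ps = ps' \<and> qs = qs'"
    using ps qs by (auto simp: sorted_lists_over_def intro: sorted_permutation_unique)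
qed

theorem theorem3p4:
  fixes gr :: "nat \<Rightarrow> 'a::real_algebra_1 set"
    and \<Delta> :: "'a \<Rightarrow> 'a tensors"
    and \<epsilon> :: "'a \<Rightarrow> real"
    and S \<tau> :: "'a \<Rightarrow> 'a"
    and a :: nat
  assumes hopf: "graded_connected_hopf_algebra gr \<Delta> \<epsilon> S"
    and linear: "linear \<tau>"
    and graded: "\<And>n x. x \<in> gr n \<Longrightarrow> \<tau> x \<in> gr n"
    and involution: "\<And>x. \<tau> (\<tau> x) = x"
    and algebra_morphism: "\<And>w z. \<tau> (w * z) = \<tau> w * \<tau> z"
    and coalgebra: "coalgebra_morphism \<Delta> \<tau> \<or> coalgebra_antimorphism \<Delta> \<tau>"
    and odd: "odd a"
  shows
    "(\<forall>ps qs. set ps \<subseteq> eigenspace_in (primitives \<Delta>) \<tau> 1 \<longrightarrow>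
              set qs \<subseteq> eigenspace_in (primitives \<Delta>) \<tau> (-1) \<longrightarrow>
        tau_plus \<Delta> \<tau> a (symmetrized_product ps qs)
          = (real a ^ length ps) *\<^sub>R symmetrized_product ps qs \<and>
        tau_minus \<Delta> \<tau> a (symmetrized_product ps qs)
          = ((-1) ^ length qs * real a ^ length ps) *\<^sub>R symmetrized_product ps qs \<and>
        (0 \<notin> set ps \<union> set qs \<longrightarrow> symmetrized_product ps qs \<noteq> 0))
     \<and>
     (\<forall>P Q r s.
        is_basis_of P (eigenspace_in (primitives \<Delta>) \<tau> 1) \<longrightarrow>
        is_basis_of Q (eigenspace_in (primitives \<Delta>) \<tau> (-1)) \<longrightarrow>
        linear_order_on P r \<longrightarrow> linear_order_on Q s \<longrightarrow>
        (let I = sorted_lists_over P r \<times> sorted_lists_over Q s;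
             v = (\<lambda>(ps, qs). symmetrized_product ps qs)
         in inj_on v I \<and> independent (v ` I) \<and>
            (cocommutative \<Delta> \<longrightarrow>
               is_basis_of (v ` I) UNIV \<and>
               (\<forall>x \<in> v ` I. (\<exists>c. is_eigenvector (tau_plus \<Delta> \<tau> a) c x) \<and>
                            (\<exists>c. is_eigenvector (tau_minus \<Delta> \<tau> a) c x)))))"
proof -
  interpret graded_connected_hopf_algebra gr \<Delta> \<epsilon> S by (rule hopf)
  let ?P = "eigenspace_in (primitives \<Delta>) \<tau> 1" and ?Q = "eigenspace_in (primitives \<Delta>) \<tau> (-1)"
  have P: "x \<in> primitives \<Delta> \<and> \<tau> x = x" if "x \<in> ?P" for x
    using that by (simp add: eigenspace_in_def)
  have Q: "x \<in> primitives \<Delta> \<and> \<tau> x = - x" if "x \<in> ?Q" for x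
    using that by (simp add: eigenspace_in_def)
  \<comment> \<open>Being onto, \<open>\<tau>\<close> sends 1 to a neutral element.\<close>
  have tau_one: "\<tau> 1 = 1"
    using algebra_morphism[of 1 "\<tau> 1"] involution[of 1] by simp
  \<comment> \<open>The coproduct of a primitive element is symmetric, so morphisms and
    antimorphisms agree on it.\<close>
  have tau_prim: "\<tau> x \<in> primitives \<Delta>" if "x \<in> primitives \<Delta>" for x
  proof -
    have linT: "linear (tensor_map [\<tau>, \<tau>])" by (simp add: linear_tensor_map linear)
    have flip: "bilinear (\<lambda>u v. pure_tensor [v, u :: 'a])"
      by (intro bilinearI linear_pure_tensor_2)
    have x: "\<Delta> x = pure_tensor [1, x] + pure_tensor [x, 1]" using that by (simp add: primitives_def)
    have "tensor_swap (\<Delta> x) = \<Delta> x"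
      by (simp add: x tensor_swap_def linear_add[OF linear_tensor_lift2[OF flip]] tensor_lift2_pure[OF flip])
    then have "\<Delta> (\<tau> x) = tensor_map [\<tau>, \<tau>] (\<Delta> x)"
      using coalgebra by (auto simp: coalgebra_morphism_def coalgebra_antimorphism_def)
    also have "\<dots> = pure_tensor [1, \<tau> x] + pure_tensor [\<tau> x, 1]"
      by (simp add: x linear_add[OF linT] tensor_map_pure linear tau_one)
    finally show ?thesis by (simp add: primitives_def)
  qed
  have plus: "tau_plus \<Delta> \<tau> a (symmetrized_product ps qs) = (real a ^ length ps) *\<^sub>R symmetrized_product ps qs"
    and minus: "tau_minus \<Delta> \<tau> a (symmetrized_product ps qs) =
      ((-1) ^ length qs * real a ^ length ps) *\<^sub>R symmetrized_product ps qs"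
    if "set ps \<subseteq> ?P" "set qs \<subseteq> ?Q" for ps qs
  proof -
    have *: "p \<in> set ps \<Longrightarrow> p \<in> primitives \<Delta> \<and> \<tau> p = p" "q \<in> set qs \<Longrightarrow> q \<in> primitives \<Delta> \<and> \<tau> q = - q" for p q
      using that P Q by auto
    show "tau_plus \<Delta> \<tau> a (symmetrized_product ps qs) = (real a ^ length ps) *\<^sub>R symmetrized_product ps qs"
      unfolding tau_plus_eq
      using alternating_symmetrized_product[of id \<tau> ps qs 1 a] * linear tau_one algebra_morphism odd
      by (simp add: linear_id)
    show "tau_minus \<Delta> \<tau> a (symmetrized_product ps qs) =
        ((-1) ^ length qs * real a ^ length ps) *\<^sub>R symmetrized_product ps qs"
      unfolding tau_minus_eq
      using alternating_symmetrized_product[of \<tau> id ps qs "-1" a] * linear tau_one algebra_morphism odd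
      by (simp add: linear_id)
  qed
  have nonzero: "symmetrized_product ps qs \<noteq> 0"
    if "set ps \<subseteq> ?P" "set qs \<subseteq> ?Q" "0 \<notin> set ps \<union> set qs" for ps qs
    using that P Q by (intro symmetrized_product_nonzero) auto
  have basis: "inj_on v I \<and> independent (v ` I) \<and>
      (cocommutative \<Delta> \<longrightarrow> is_basis_of (v ` I) UNIV \<and>
        (\<forall>x \<in> v ` I. (\<exists>c. is_eigenvector (tau_plus \<Delta> \<tau> a) c x) \<and> (\<exists>c. is_eigenvector (tau_minus \<Delta> \<tau> a) c x)))"
    if bases: "is_basis_of P ?P" "is_basis_of Q ?Q" and orders: "linear_order_on P r" "linear_order_on Q s"
      and I_def: "I = sorted_lists_over P r \<times> sorted_lists_over Q s"
      and v_def: "v = (\<lambda>(ps, qs). symmetrized_product ps qs)" for P Q r s I v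
  proof -
    have indep: "independent P" "independent Q" and span: "span P = ?P" "span Q = ?Q"
      using bases by (auto simp: is_basis_of_def)
    have sub: "P \<subseteq> ?P" "Q \<subseteq> ?Q" using span span_superset by blast+
    \<comment> \<open>A common element satisfies \<open>x = - x\<close>, but 0 lies in no
      independent set.\<close>
    have disj: "P \<inter> Q = {}"
    proof (rule ccontr)
      assume "P \<inter> Q \<noteq> {}"
      then obtain x where x: "x \<in> P" "x \<in> Q" by blast
      then have "\<tau> x = x" "\<tau> x = - x" using P Q sub by blast+
      then have "2 *\<^sub>R x = 0" by (metis add.right_inverse scaleR_2)
      then show False using x indep(1) dependent_zero by auto
    qed
    have B: "independent (P \<union> Q)"
      using sub P Q by (intro independent_Un_eigenspaces[OF linear indep]) auto
    have BP: "P \<union> Q \<subseteq> primitives \<Delta>" using sub P Q by blast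
    have I: "set ps \<union> set qs \<subseteq> P \<union> Q" if "(ps, qs) \<in> I" for ps qs
      using that by (auto simp: I_def sorted_lists_over_def)
    have inj: "inj_on (\<lambda>(ps, qs). mset (ps @ qs)) I"
      unfolding I_def by (rule sorted_lists_over_mset_inj[OF orders disj])
    note * = symmetrized_products_inj_independent[OF B BP I inj, folded v_def]
    have "span (v ` I) = UNIV" if "cocommutative \<Delta>"
      unfolding v_def I_def
    proof (rule span_symmetrized_products[OF that _ orders])
      \<comment> \<open>Split \<open>x\<close> into its invariant and anti-invariant halves;
        \<open>tau_prim\<close> keeps both primitive.\<close>
      have "x \<in> span (P \<union> Q)" if x: "x \<in> primitives \<Delta>" for x
      proof -
        have "(1/2) *\<^sub>R (x + \<tau> x) \<in> ?P" "(1/2) *\<^sub>R (x - \<tau> x) \<in> ?Q"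
          using x tau_prim[OF x] subspace_primitives
          by (auto simp: eigenspace_in_def linear_add[OF linear] linear_diff[OF linear] linear_scale[OF linear]
              involution algebra_simps intro!: subspace_add subspace_diff subspace_scale)
        then have "(1/2) *\<^sub>R (x + \<tau> x) + (1/2) *\<^sub>R (x - \<tau> x) \<in> span (P \<union> Q)"
          unfolding span[symmetric] by (meson span_add span_mono Un_upper1 Un_upper2 subsetD)
        moreover have "(1/2) *\<^sub>R (x + \<tau> x) + (1/2) *\<^sub>R (x - \<tau> x) = x"
          by (simp add: algebra_simps flip: scaleR_add_left)
        ultimately show ?thesis by simp
      qed
      then show "primitives \<Delta> = span (P \<union> Q)"
        using span_minimal[OF BP subspace_primitives] by auto
    qed
    moreover have "(\<exists>c. is_eigenvector (tau_plus \<Delta> \<tau> a) c x) \<and> (\<exists>c. is_eigenvector (tau_minus \<Delta> \<tau> a) c x)"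
      if x: "x \<in> v ` I" for x
    proof -
      obtain ps qs where pq: "x = symmetrized_product ps qs" "(ps, qs) \<in> I" using x by (auto simp: v_def)
      then have "set ps \<subseteq> ?P" "set qs \<subseteq> ?Q"
        using sub by (auto simp: I_def sorted_lists_over_def)
      moreover have "x \<noteq> 0" using *(2) x dependent_zero by blast
      ultimately show ?thesis
        using plus minus unfolding is_eigenvector_def pq(1) by blast
    qed
    ultimately show ?thesis using * by (simp add: is_basis_of_def)
  qed
  show ?thesis
    unfolding Let_def using plus minus nonzero basis[OF _ _ _ _ refl refl] by blast
qed

end
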